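(* The class of languages recognisable in $O(1)$ time by an $\mathrm{ASRAM}[+,/,\leftarrow,\mathit{Bool}]$ equals the arithmetical hierarchy $\mathrm{AH}=\bigcup_{i\ge 0}(\Sigma^0_i\cup\Pi^0_i)$.
   Context: A $\mathrm{RAM}[\mathit{op}]$ is a unit-cost random access machine with registers holding nonnegative integers, direct and indirect addressing, conditional jumps, an equality comparator, and the operations in $\mathit{op}$ each costing one time unit. Here $+$ is addition, $/$ is exact division (giving $a/b$, defined only when $b$ divides $a$), $a\leftarrow b=a\cdot 2^b$, and $\mathit{Bool}$ denotes the bitwise Boolean operations. The input integer is placed in $R[0]$, other registers are $0$; the machine accepts iff $R[0]\neq 0$ at termination. ALS set: a nonempty set $\mathbf{S}$ of infinite integer sequences such that for every $i$ and every $\{A_k\}\in\mathbf{S}$ there is $\{B_k\}\in\mathbf{S}$ with $B_i=A_i+1$ and $B_j=A_j$ for all $j<i$. ASRAM: an $\mathrm{ASRAM}[\mathit{op}]$ is a $\mathrm{RAM}[\mathit{op}]$ program that may also call a pseudofunction $\mathit{ALN}()$ returning an integer. It computes $f$ if for each input $\mathit{inp}$ there is an ALS set $\mathbf{S}$ such that for every $\{A_i\}\in\mathbf{S}$, replacing the $i$-th invocation of $\mathit{ALN}()$ by $A_i$ yields a RAM computing $f(\mathit{inp})$. It recognises a language $L\subseteq\mathbb{N}$ if it computes a function nonzero exactly on $L$. Its running time on $\mathit{inp}$ is the worst case over all sequences $\{A_i\}$ of the running time of the resulting RAM; $O(1)$ time means this is bounded by a constant independent of the input. *)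

theory Defs
  imports Main
begin

text \<open>Bitwise application of a binary Boolean function. Meaningful (and only used)
  when f False False = False, so that the result is a finite bit string.\<close>

function bitop :: "(bool \<Rightarrow> bool \<Rightarrow> bool) \<Rightarrow> nat \<Rightarrow> nat \<Rightarrow> nat" where
  "bitop f a b = (if a = 0 \<and> b = 0 then 0
     else of_bool (f (odd a) (odd b)) + 2 * bitop f (a div 2) (b div 2))"
  by auto
termination by (relation "measure (\<lambda>(f, a, b). a + b)") auto

datatype instr =
    LoadConst nat nat
  | Move nat nat
  | LoadInd nat nat
  | StoreInd nat nat
  | Add nat nat nat
  | ExDiv nat nat nat
  | Shl nat nat nat
  | BoolOp "bool \<Rightarrow> bool \<Rightarrow> bool" nat nat nat
  | JumpEq nat nat nat
  | Aln nat
  | Halt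

text \<open>State: program counter, registers, number of ALN invocations so far.\<close>
type_synonym state = "nat \<times> (nat \<Rightarrow> nat) \<times> nat"

definition final :: "instr list \<Rightarrow> state \<Rightarrow> bool" where
  "final P s = (fst s \<ge> length P \<or> P ! fst s = Halt)"

text \<open>One step; None means abnormal termination (undefined operation).
  The sequence A supplies the values of successive ALN invocations.\<close>
definition step :: "instr list \<Rightarrow> (nat \<Rightarrow> nat) \<Rightarrow> state \<Rightarrow> state option" where
  "step P A s = (case s of (pc, R, k) \<Rightarrow>
     if final P s then Some s else
     (case P ! pc of
        LoadConst d c \<Rightarrow> Some (Suc pc, R(d := c), k)
      | Move d a \<Rightarrow> Some (Suc pc, R(d := R a), k)
      | LoadInd d a \<Rightarrow> Some (Suc pc, R(d := R (R a)), k)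
      | StoreInd d a \<Rightarrow> Some (Suc pc, R(R d := R a), k)
      | Add d a b \<Rightarrow> Some (Suc pc, R(d := R a + R b), k)
      | ExDiv d a b \<Rightarrow> (if R b \<noteq> 0 \<and> R b dvd R a
                         then Some (Suc pc, R(d := R a div R b), k) else None)
      | Shl d a b \<Rightarrow> Some (Suc pc, R(d := R a * 2 ^ R b), k)
      | BoolOp f d a b \<Rightarrow> (if \<not> f False False
                         then Some (Suc pc, R(d := bitop f (R a) (R b)), k) else None)
      | JumpEq a b t \<Rightarrow> Some (if R a = R b then t else Suc pc, R, k)
      | Aln d \<Rightarrow> Some (Suc pc, R(d := A k), Suc k)
      | Halt \<Rightarrow> Some s))"

fun run :: "instr list \<Rightarrow> (nat \<Rightarrow> nat) \<Rightarrow> state \<Rightarrow> nat \<Rightarrow> state option" where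
  "run P A s 0 = Some s"
| "run P A s (Suc n) = (case step P A s of None \<Rightarrow> None | Some s' \<Rightarrow> run P A s' n)"

definition init :: "nat \<Rightarrow> state" where
  "init inp = (0, (\<lambda>_. 0)(0 := inp), 0)"

definition halts_with :: "instr list \<Rightarrow> (nat \<Rightarrow> nat) \<Rightarrow> nat \<Rightarrow> nat \<Rightarrow> bool" where
  "halts_with P A inp v = (\<exists>n s. run P A (init inp) n = Some s \<and> final P s \<and> fst (snd s) 0 = v)"

definition stops_within :: "instr list \<Rightarrow> (nat \<Rightarrow> nat) \<Rightarrow> nat \<Rightarrow> nat \<Rightarrow> bool" where
  "stops_within P A inp t = (\<exists>n\<le>t. run P A (init inp) n = None \<or>
       (\<exists>s. run P A (init inp) n = Some s \<and> final P s))"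

definition ALS :: "(nat \<Rightarrow> nat) set \<Rightarrow> bool" where
  "ALS S = (S \<noteq> {} \<and> (\<forall>i. \<forall>A\<in>S. \<exists>B\<in>S. B i = A i + 1 \<and> (\<forall>j<i. B j = A j)))"

definition asram_computes :: "instr list \<Rightarrow> (nat \<Rightarrow> nat) \<Rightarrow> bool" where
  "asram_computes P f = (\<forall>inp. \<exists>S. ALS S \<and> (\<forall>A\<in>S. halts_with P A inp (f inp)))"

definition asram_recognises :: "instr list \<Rightarrow> nat set \<Rightarrow> bool" where
  "asram_recognises P L = (\<exists>f. asram_computes P f \<and> (\<forall>n. f n \<noteq> 0 \<longleftrightarrow> n \<in> L))"

definition asram_const_time :: "instr list \<Rightarrow> bool" where
  "asram_const_time P = (\<exists>T. \<forall>inp A. stops_within P A inp T)"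

definition ASRAM_O1 :: "nat set set" where
  "ASRAM_O1 = {L. \<exists>P. asram_recognises P L \<and> asram_const_time P}"

datatype tm = Var nat | Zero | Sc tm | Pl tm tm | Tm tm tm

datatype fm = Eq tm tm | Lt tm tm | Neg fm | Conj fm fm | Disj fm fm
  | BEx tm fm   \<comment> \<open>\<exists>x < t. phi  (t evaluated outside the binder)\<close>
  | BAll tm fm
  | Ex fm | All fm

fun tval :: "(nat \<Rightarrow> nat) \<Rightarrow> tm \<Rightarrow> nat" where
  "tval e (Var i) = e i"
| "tval e Zero = 0"
| "tval e (Sc t) = Suc (tval e t)"
| "tval e (Pl t u) = tval e t + tval e u"
| "tval e (Tm t u) = tval e t * tval e u"

definition cons_env :: "nat \<Rightarrow> (nat \<Rightarrow> nat) \<Rightarrow> nat \<Rightarrow> nat" where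
  "cons_env x e = (\<lambda>i. if i = 0 then x else e (i - 1))"

fun sat :: "(nat \<Rightarrow> nat) \<Rightarrow> fm \<Rightarrow> bool" where
  "sat e (Eq t u) = (tval e t = tval e u)"
| "sat e (Lt t u) = (tval e t < tval e u)"
| "sat e (Neg p) = (\<not> sat e p)"
| "sat e (Conj p q) = (sat e p \<and> sat e q)"
| "sat e (Disj p q) = (sat e p \<or> sat e q)"
| "sat e (BEx t p) = (\<exists>x < tval e t. sat (cons_env x e) p)"
| "sat e (BAll t p) = (\<forall>x < tval e t. sat (cons_env x e) p)"
| "sat e (Ex p) = (\<exists>x. sat (cons_env x e) p)"
| "sat e (All p) = (\<forall>x. sat (cons_env x e) p)"

fun delta0 :: "fm \<Rightarrow> bool" where
  "delta0 (Eq _ _) = True"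
| "delta0 (Lt _ _) = True"
| "delta0 (Neg p) = delta0 p"
| "delta0 (Conj p q) = (delta0 p \<and> delta0 q)"
| "delta0 (Disj p q) = (delta0 p \<and> delta0 q)"
| "delta0 (BEx _ p) = delta0 p"
| "delta0 (BAll _ p) = delta0 p"
| "delta0 (Ex _) = False"
| "delta0 (All _) = False"

inductive sigma_fm :: "nat \<Rightarrow> fm \<Rightarrow> bool" and pi_fm :: "nat \<Rightarrow> fm \<Rightarrow> bool" where
  "delta0 p \<Longrightarrow> sigma_fm n p"
| "delta0 p \<Longrightarrow> pi_fm n p"
| "pi_fm n p \<Longrightarrow> sigma_fm (Suc n) p"
| "sigma_fm (Suc n) p \<Longrightarrow> sigma_fm (Suc n) (Ex p)"
| "sigma_fm n p \<Longrightarrow> pi_fm (Suc n) p"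
| "pi_fm (Suc n) p \<Longrightarrow> pi_fm (Suc n) (All p)"

definition defined_set :: "fm \<Rightarrow> nat set" where
  "defined_set p = {m. sat ((\<lambda>_. 0)(0 := m)) p}"

definition Sigma0 :: "nat \<Rightarrow> nat set set" where
  "Sigma0 i = {L. \<exists>p. sigma_fm i p \<and> L = defined_set p}"

definition Pi0 :: "nat \<Rightarrow> nat set set" where
  "Pi0 i = {L. \<exists>p. pi_fm i p \<and> L = defined_set p}"

definition AH :: "nat set set" where
  "AH = (\<Union>i. Sigma0 i \<union> Pi0 i)"

end

theory Submission
  imports Defs "HOL-Number_Theory.Cong"
begin

text \<open>
  Quantifying over an ALS set means \<open>for almost all A\<^sub>0, for almost all A\<^sub>1, \<dots>\<close>. The outcome of a
  run of constant length is an arithmetical predicate of the input and the numbers \<open>A\<^sub>i\<close>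
  (exponentiation is definable by Goedel's \<open>\<beta>\<close> function), and so is its closure under finitely many
  such quantifiers.

  Conversely, the unbounded quantifiers of an arithmetical formula may be bounded by
  \<open>2 ^ A\<^sub>0, 2 ^ A\<^sub>1, \<dots>\<close>, where each \<open>A\<^sub>i\<close> is large enough depending on the previous ones. The truth
  table of the bounded formula is a single huge number with fields whose widths are powers of two.
  Tables of variables and of products of distinct variables arise from geometric sums, that is, by
  shifts, subtractions and exact divisions by \<open>2 ^ W - 1\<close>; equality is tested in all fields at once,
  and a quantifier merges adjacent fields into one.
\<close>

text \<open>Witnesses of unbounded quantifiers may outgrow every bound that a machine can compute
  from its input in constant time. The ALN values supply the bounds, because an ALS set can make
  each entry large relative to the input and to all earlier entries. Multiplication is not an
  instruction. The products that occur have a geometric sum as one factor, and exact division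
  provides exactly those; a variable occurring twice in a monomial would leave this class. Widths
  and numbers of fields are powers of two so that their products, which serve as shift distances,
  come from adding exponents. The almost-all quantifiers commute with conjunction and never hold of
  a contradiction. Hence acceptance and rejection cannot both hold for almost all values, and one
  formula can read off the answer.\<close>

subsection \<open>Bitwise operations\<close>

declare bitop.simps [simp del]

lemma bitop_0_0 [simp]: "bitop f 0 0 = 0"
  by (subst bitop.simps) simp

lemma bitop_rec:
  assumes "a \<noteq> 0 \<or> b \<noteq> 0 \<or> \<not> f False False"
  shows "bitop f a b = of_bool (f (odd a) (odd b)) + 2 * bitop f (a div 2) (b div 2)"
proof (cases "a = 0 \<and> b = 0")
  case True
  then show ?thesis using assms by simp
next
  case False
  then show ?thesis by (subst bitop.simps) (simp only: if_False)
qed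

lemma bit_bitop:
  assumes "\<not> f False False"
  shows "bit (bitop f a b) i = f (bit a i) (bit b i)"
  using assms
proof (induction f a b arbitrary: i rule: bitop.induct)
  case (1 f a b)
  show ?case
  proof (cases "a = 0 \<and> b = 0")
    case True
    then show ?thesis using 1(2) by simp
  next
    case False
    have eq: "bitop f a b = of_bool (f (odd a) (odd b)) + 2 * bitop f (a div 2) (b div 2)"
      using False by (intro bitop_rec) auto
    show ?thesis
    proof (cases i)
      case 0
      then show ?thesis by (simp add: eq bit_0)
    next
      case (Suc j)
      have "bitop f a b div 2 = bitop f (a div 2) (b div 2)"
        by (simp add: eq)
      then show ?thesis
        using 1(1)[OF False 1(2), of j] by (simp add: Suc bit_Suc)
    qed
  qed
qed

lemma bitop_and: "bitop (\<and>) a b = and a b"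
  by (rule bit_eqI) (simp add: bit_bitop bit_and_iff)

lemma bitop_xor: "bitop (\<noteq>) a b = xor a b"
  by (rule bit_eqI) (simp add: bit_bitop bit_xor_iff)

text \<open>Subtracting from an all-ones number needs no borrows, so it is a bitwise operation;
  \<open>computable_diff\<close> reduces general subtraction to it.\<close>

lemma mask_minus_nat:
  fixes b :: nat
  assumes "b < 2 ^ n"
  shows "bitop (\<lambda>x y. x \<and> \<not> y) (2 ^ n - 1) b = 2 ^ n - 1 - b"
proof -
  let ?m = "bitop (\<lambda>x y. x \<and> \<not> y) (2 ^ n - 1) b"
  have m: "2 ^ n - 1 = (mask n :: nat)" by (simp add: mask_nat_def)
  have b: "bit b i \<Longrightarrow> i < n" for i
    using assms by (metis bit_take_bit_iff take_bit_nat_eq_self)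
  have "?m + b = or ?m b"
    by (rule disjunctive_add) (simp add: bit_bitop)
  also have "\<dots> = mask n"
    
    by (rule bit_eqI) (use b in \<open>auto simp: bit_or_iff bit_bitop m bit_mask_iff simp del: One_nat_def\<close>)
  finally show ?thesis using m by simp
qed

text \<open>Bitwise operations have no carries, so low and high parts do not interact. This is why
  they act on packed vectors field by field.\<close>

lemma bitop_append:
  assumes "\<not> f False False" "a < 2 ^ k" "b < 2 ^ k"
  shows "bitop f (a + 2 ^ k * a') (b + 2 ^ k * b') = bitop f a b + 2 ^ k * bitop f a' b'"
  using assms(2,3)
proof (induction k arbitrary: a b)
  case 0
  then show ?case by simp
next
  case (Suc k)
  have half: "(x + 2 ^ Suc k * y) div 2 = x div 2 + 2 ^ k * y" for x y :: nat
  proof -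
    have "x + 2 ^ Suc k * y = x + 2 * (2 ^ k * y)" by simp
    then show ?thesis by (metis div_mult_self2 zero_neq_numeral add.commute)
  qed
  have unf: "bitop f x y = of_bool (f (odd x) (odd y)) + 2 * bitop f (x div 2) (y div 2)" for x y
    using assms(1) by (intro bitop_rec) simp
  have "bitop f (a + 2 ^ Suc k * a') (b + 2 ^ Suc k * b')
      = of_bool (f (odd a) (odd b)) + 2 * bitop f (a div 2 + 2 ^ k * a') (b div 2 + 2 ^ k * b')"
    by (subst unf, subst (1 2) half) simp
  also have "\<dots> = of_bool (f (odd a) (odd b)) + 2 * (bitop f (a div 2) (b div 2) + 2 ^ k * bitop f a' b')"
    using Suc by (subst Suc.IH) auto
  also have "\<dots> = bitop f a b + 2 ^ Suc k * bitop f a' b'"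
    by (subst (2) unf) (simp add: algebra_simps)
  finally show ?case .
qed

subsection \<open>Straight-line programs\<close>

text \<open>The recogniser needs neither jumps nor indirect addressing, so an expression over the
  input and the ALN values describes it fully and constant time comes for free.\<close>

datatype expr = EVar nat | EConst nat | EAdd expr expr | EDiv expr expr | EShl expr expr
  | EBool "bool \<Rightarrow> bool \<Rightarrow> bool" expr expr

fun eval :: "expr \<Rightarrow> (nat \<Rightarrow> nat) \<Rightarrow> nat" where
  "eval (EVar i) v = v i"
| "eval (EConst c) v = c"
| "eval (EAdd x y) v = eval x v + eval y v"
| "eval (EDiv x y) v = eval x v div eval y v"
| "eval (EShl x y) v = eval x v * 2 ^ eval y v"
| "eval (EBool f x y) v = bitop f (eval x v) (eval y v)"

text \<open>\<open>eval\<close> uses the total \<open>div\<close>; the conditions under which the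
  machine would not abort are kept apart here.\<close>

fun regular :: "expr \<Rightarrow> (nat \<Rightarrow> nat) \<Rightarrow> bool" where
  "regular (EVar i) v = True"
| "regular (EConst c) v = True"
| "regular (EAdd x y) v = (regular x v \<and> regular y v)"
| "regular (EDiv x y) v = (regular x v \<and> regular y v \<and> eval y v \<noteq> 0 \<and> eval y v dvd eval x v)"
| "regular (EShl x y) v = (regular x v \<and> regular y v)"
| "regular (EBool f x y) v = (regular x v \<and> regular y v \<and> \<not> f False False)"

fun vars_below :: "nat \<Rightarrow> expr \<Rightarrow> bool" where
  "vars_below n (EVar i) = (i < n)"
| "vars_below n (EConst c) = True"
| "vars_below n (EAdd x y) = (vars_below n x \<and> vars_below n y)"
| "vars_below n (EDiv x y) = (vars_below n x \<and> vars_below n y)"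
| "vars_below n (EShl x y) = (vars_below n x \<and> vars_below n y)"
| "vars_below n (EBool f x y) = (vars_below n x \<and> vars_below n y)"

lemma vars_below_mono: "vars_below m x \<Longrightarrow> m \<le> n \<Longrightarrow> vars_below n x"
  by (induction x) auto

lemma ex_vars_below: "\<exists>n. vars_below n x"
proof (induction x)
  case (EVar i)
  then show ?case by (intro exI[of _ "Suc i"]) simp
qed (simp, (metis vars_below.simps(3-) vars_below_mono max.cobounded1 max.cobounded2)+)

lemma eval_regular_cong:
  assumes "vars_below n x" "\<And>i. i < n \<Longrightarrow> u i = v i"
  shows "eval x u = eval x v \<and> regular x u = regular x v"
  using assms by (induction x) auto

text \<open>Stack discipline: registers from \<open>d\<close> on are scratch, while those below
  \<open>d\<close> hold the variables and pending operands and survive.\<close>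

fun code :: "expr \<Rightarrow> nat \<Rightarrow> instr list" where
  "code (EVar i) d = [Move d i]"
| "code (EConst c) d = [LoadConst d c]"
| "code (EAdd x y) d = code x d @ code y (Suc d) @ [Add d d (Suc d)]"
| "code (EDiv x y) d = code x d @ code y (Suc d) @ [ExDiv d d (Suc d)]"
| "code (EShl x y) d = code x d @ code y (Suc d) @ [Shl d d (Suc d)]"
| "code (EBool f x y) d = code x d @ code y (Suc d) @ [BoolOp f d d (Suc d)]"

lemma run_add: "run P A s (m + n) = (case run P A s m of None \<Rightarrow> None | Some s' \<Rightarrow> run P A s' n)"
  by (induction m arbitrary: s) (auto split: option.split)

text \<open>Quantifying over the surrounding program makes fragments position independent, so they
  compose by concatenation; one step per instruction is right because nothing jumps.\<close>

definition executes :: "instr list \<Rightarrow> (nat \<Rightarrow> nat) \<Rightarrow> (nat \<Rightarrow> nat) \<Rightarrow> nat \<Rightarrow> (nat \<Rightarrow> nat) \<Rightarrow> nat \<Rightarrow> bool" where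
  "executes c A R k R' k' = (\<forall>pre post. run (pre @ c @ post) A (length pre, R, k) (length c)
      = Some (length pre + length c, R', k'))"

lemma executes_append:
  assumes "executes c A R k R' k'" "executes c' A R' k' R'' k''"
  shows "executes (c @ c') A R k R'' k''"
  unfolding executes_def
proof (intro allI)
  fix pre post
  have "run (pre @ c @ c' @ post) A (length pre, R, k) (length c) = Some (length pre + length c, R', k')"
    using assms(1) unfolding executes_def by blast
  moreover have "run ((pre @ c) @ c' @ post) A (length (pre @ c), R', k') (length c')
      = Some (length (pre @ c) + length c', R'', k'')"
    using assms(2) unfolding executes_def by blast
  ultimately show "run (pre @ (c @ c') @ post) A (length pre, R, k) (length (c @ c'))
      = Some (length pre + length (c @ c'), R'', k'')"
    by (simp add: run_add add.assoc)
qed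

lemma executes_Nil: "executes [] A R k R k"
  by (simp add: executes_def)

lemma executes_single:
  assumes "i \<noteq> Halt" "\<And>pre post. step (pre @ [i] @ post) A (length pre, R, k) = Some (Suc (length pre), R', k')"
  shows "executes [i] A R k R' k'"
  using assms by (simp add: executes_def)

lemma executes_binary:
  assumes x: "\<exists>R1. executes cx A R k R1 k \<and> R1 d = a \<and> (\<forall>i<d. R1 i = R i)"
    and y: "\<And>R1. \<forall>i<d. R1 i = R i \<Longrightarrow>
      \<exists>R2. executes cy A R1 k R2 k \<and> R2 (Suc d) = b \<and> (\<forall>i<Suc d. R2 i = R1 i)"
    and op: "\<And>R2. R2 d = a \<Longrightarrow> R2 (Suc d) = b \<Longrightarrow> executes [ins] A R2 k (R2(d := r)) k"
  shows "\<exists>R'. executes (cx @ cy @ [ins]) A R k R' k \<and> R' d = r \<and> (\<forall>i<d. R' i = R i)"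
proof -
  obtain R1 where R1: "executes cx A R k R1 k" "R1 d = a" "\<forall>i<d. R1 i = R i"
    using x by blast
  obtain R2 where R2: "executes cy A R1 k R2 k" "R2 (Suc d) = b" "\<forall>i<Suc d. R2 i = R1 i"
    using y[OF R1(3)] by blast
  have "executes [ins] A R2 k (R2(d := r)) k"
    using R1(2) R2(2,3) by (intro op) auto
  then have "executes (cx @ cy @ [ins]) A R k (R2(d := r)) k"
    using R1(1) R2(1) executes_append by blast
  moreover have "(R2(d := r)) d = r \<and> (\<forall>i<d. (R2(d := r)) i = R i)"
    using R1(3) R2(3) by simp
  ultimately show ?thesis by blast
qed

lemma executes_code:
  assumes "vars_below d x" "regular x R"
  shows "\<exists>R'. executes (code x d) A R k R' k \<and> R' d = eval x R \<and> (\<forall>i<d. R' i = R i)"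
proof -
  \<comment> \<open>The second operand is evaluated one register higher and in an altered register
    state; its value depends only on registers below \<open>d\<close>, which are unchanged.\<close>
  have weaken: "\<exists>R2. executes (code y (Suc d)) A R1 k R2 k \<and> R2 (Suc d) = eval y R \<and> (\<forall>i<Suc d. R2 i = R1 i)"
    if "vars_below d y" "regular y R" "\<forall>i<d. R1 i = R i"
      and IH: "\<And>d R. vars_below d y \<Longrightarrow> regular y R \<Longrightarrow>
        \<exists>R'. executes (code y d) A R k R' k \<and> R' d = eval y R \<and> (\<forall>i<d. R' i = R i)"
    for y d R R1
  proof -
    have e: "eval y R1 = eval y R \<and> regular y R1 = regular y R"
      by (rule eval_regular_cong[OF that(1)]) (use that in simp)
    then show ?thesis
      using IH[of "Suc d" R1] vars_below_mono[OF that(1), of "Suc d"] that(2) by simp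
  qed
  show ?thesis
    using assms
  proof (induction x arbitrary: d R)
    case (EVar i)
    have "executes [Move d i] A R k (R(d := R i)) k"
      by (rule executes_single) (auto simp: step_def final_def)
    then show ?case unfolding code.simps eval.simps by (intro exI conjI, assumption) auto
  next
    case (EConst c)
    have "executes [LoadConst d c] A R k (R(d := c)) k"
      by (rule executes_single) (auto simp: step_def final_def)
    then show ?case unfolding code.simps eval.simps by (intro exI conjI, assumption) auto
  next
    case (EAdd x y)
    then have x: "vars_below d x" "regular x R" and y: "vars_below d y" "regular y R" by auto
    show ?case unfolding code.simps
    proof (rule executes_binary[OF EAdd.IH(1)[OF x] weaken[OF y _ EAdd.IH(2)]])
      fix R2 assume R2: "R2 d = eval x R" "R2 (Suc d) = eval y R"
      show "executes [Add d d (Suc d)] A R2 k (R2(d := eval (EAdd x y) R)) k"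
        by (rule executes_single) (use EAdd.prems R2 in \<open>auto simp: step_def final_def\<close>)
    qed
  next
    case (EDiv x y)
    then have x: "vars_below d x" "regular x R" and y: "vars_below d y" "regular y R" by auto
    show ?case unfolding code.simps
    proof (rule executes_binary[OF EDiv.IH(1)[OF x] weaken[OF y _ EDiv.IH(2)]])
      fix R2 assume R2: "R2 d = eval x R" "R2 (Suc d) = eval y R"
      show "executes [ExDiv d d (Suc d)] A R2 k (R2(d := eval (EDiv x y) R)) k"
        by (rule executes_single) (use EDiv.prems R2 in \<open>auto simp: step_def final_def\<close>)
    qed
  next
    case (EShl x y)
    then have x: "vars_below d x" "regular x R" and y: "vars_below d y" "regular y R" by auto
    show ?case unfolding code.simps
    proof (rule executes_binary[OF EShl.IH(1)[OF x] weaken[OF y _ EShl.IH(2)]])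
      fix R2 assume R2: "R2 d = eval x R" "R2 (Suc d) = eval y R"
      show "executes [Shl d d (Suc d)] A R2 k (R2(d := eval (EShl x y) R)) k"
        by (rule executes_single) (use EShl.prems R2 in \<open>auto simp: step_def final_def\<close>)
    qed
  next
    case (EBool f x y)
    then have x: "vars_below d x" "regular x R" and y: "vars_below d y" "regular y R" by auto
    show ?case unfolding code.simps
    proof (rule executes_binary[OF EBool.IH(1)[OF x] weaken[OF y _ EBool.IH(2)]])
      fix R2 assume R2: "R2 d = eval x R" "R2 (Suc d) = eval y R"
      show "executes [BoolOp f d d (Suc d)] A R2 k (R2(d := eval (EBool f x y) R)) k"
        by (rule executes_single) (use EBool.prems R2 in \<open>auto simp: step_def final_def\<close>)
    qed
  qed
qed

definition fetch :: "nat \<Rightarrow> instr list" where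
  "fetch n = map (\<lambda>i. Aln (Suc i)) [0..<n]"

lemma executes_fetch:
  "executes (fetch n) A R 0 (\<lambda>i. if 1 \<le> i \<and> i \<le> n then A (i - 1) else R i) n"
proof (induction n)
  case 0
  have "(\<lambda>i. if 1 \<le> i \<and> i \<le> 0 then A (i - 1) else R i) = R" by auto
  then show ?case by (simp add: fetch_def executes_Nil)
next
  case (Suc n)
  let ?R = "\<lambda>n i. if 1 \<le> i \<and> i \<le> n then A (i - 1) else R i"
  have "executes [Aln (Suc n)] A (?R n) n ((?R n)(Suc n := A n)) (Suc n)"
    by (rule executes_single) (auto simp: step_def final_def)
  moreover have "(?R n)(Suc n := A n) = ?R (Suc n)" by auto
  ultimately have "executes [Aln (Suc n)] A (?R n) n (?R (Suc n)) (Suc n)" by simp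
  from executes_append[OF Suc this] show ?case by (simp add: fetch_def)
qed

definition program :: "expr \<Rightarrow> nat \<Rightarrow> instr list" where
  "program x n = fetch n @ code x (Suc n) @ [Move 0 (Suc n)]"

definition inputs :: "nat \<Rightarrow> (nat \<Rightarrow> nat) \<Rightarrow> nat \<Rightarrow> nat" where
  "inputs inp A = (\<lambda>i. if i = 0 then inp else A (i - 1))"

lemma halts_with_program:
  assumes "vars_below (Suc n) x" "regular x (inputs inp A)"
  shows "halts_with (program x n) A inp (eval x (inputs inp A))"
proof -
  let ?R0 = "(\<lambda>_. 0)(0 := inp)"
  let ?R1 = "\<lambda>i. if 1 \<le> i \<and> i \<le> n then A (i - 1) else ?R0 i"
  have c: "eval x ?R1 = eval x (inputs inp A) \<and> regular x ?R1 = regular x (inputs inp A)"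
    by (rule eval_regular_cong[OF assms(1)]) (auto simp: inputs_def)
  obtain R2 where R2: "executes (code x (Suc n)) A ?R1 n R2 n" "R2 (Suc n) = eval x ?R1"
    using executes_code[OF assms(1), of ?R1 A n] c assms(2) by auto
  have "executes [Move 0 (Suc n)] A R2 n (R2(0 := R2 (Suc n))) n"
    by (rule executes_single) (auto simp: step_def final_def)
  then have "executes (program x n) A ?R0 0 (R2(0 := R2 (Suc n))) n"
    unfolding program_def
    using executes_fetch[of n A ?R0] R2(1) by (auto intro!: executes_append)
  then have "run ([] @ program x n @ []) A (length ([]::instr list), ?R0, 0) (length (program x n))
      = Some (length ([]::instr list) + length (program x n), R2(0 := R2 (Suc n)), n)"
    unfolding executes_def by blast
  then show ?thesis
    unfolding halts_with_def init_def using R2(2) c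
    by (intro exI[of _ "length (program x n)"] exI[of _ "(length (program x n), R2(0 := R2 (Suc n)), n)"])
      (simp add: final_def)
qed

text \<open>Every step that does not abort advances the program counter by one, so after
  \<open>length P\<close> steps the run has left the program, whatever ALN returned.\<close>

lemma straight_line_const_time:
  assumes "\<And>i. i \<in> set P \<Longrightarrow> i \<noteq> Halt \<and> (\<forall>a b t. i \<noteq> JumpEq a b t)"
  shows "asram_const_time P"
proof -
  have one: "step P A s = None \<or> (\<exists>s'. step P A s = Some s' \<and> fst s' = Suc (fst s))"
    if "fst s < length P" for A s
  proof -
    obtain pc R k where s: "s = (pc, R, k)" by (cases s)
    have "P ! pc \<in> set P" using that s by simp
    from assms[OF this] show ?thesis
      using that by (cases "P ! pc") (auto simp: step_def final_def s)
  qed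
  have "run P A s n = None \<or> (\<exists>s'. run P A s n = Some s' \<and> fst s' = fst s + n)"
    if "fst s + n \<le> length P" for A s n
    using that
  proof (induction n arbitrary: s)
    case (Suc n)
    have "fst s < length P" using Suc.prems by simp
    from one[OF this, of A] show ?case
    proof
      assume "\<exists>s'. step P A s = Some s' \<and> fst s' = Suc (fst s)"
      then obtain s' where s': "step P A s = Some s'" "fst s' = Suc (fst s)" by blast
      then show ?thesis using Suc.IH[of s'] Suc.prems by simp
    qed simp
  qed simp
  from this[of "init _" "length P"] have "stops_within P A inp (length P)" for A inp
    unfolding stops_within_def by (intro exI[of _ "length P"]) (force simp: init_def final_def)
  then show ?thesis unfolding asram_const_time_def by blast
qed

lemma program_const_time: "asram_const_time (program x n)"
proof (rule straight_line_const_time)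
  have code: "i \<noteq> Halt \<and> (\<forall>a b t. i \<noteq> JumpEq a b t)" if "i \<in> set (code x d)" for i d x
    using that by (induction x arbitrary: d) auto
  fix i assume "i \<in> set (program x n)"
  then show "i \<noteq> Halt \<and> (\<forall>a b t. i \<noteq> JumpEq a b t)"
    using code[of i x "Suc n"] by (auto simp: program_def fetch_def)
qed

section \<open>Functions computed by expressions, and subtraction\<close>

text \<open>Every division occurring in the expression has to be exact for all values of the variables, not
  only for those that occur in a run: this keeps all closure properties unconditional.\<close>
definition computable :: "((nat \<Rightarrow> nat) \<Rightarrow> nat) \<Rightarrow> bool" where
  "computable F = (\<exists>x. \<forall>v. regular x v \<and> eval x v = F v)"

lemma computable_var: "computable (\<lambda>v. v i)"
  unfolding computable_def by (rule exI[of _ "EVar i"]) simp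

lemma computable_const: "computable (\<lambda>v. c)"
  unfolding computable_def by (rule exI[of _ "EConst c"]) simp

lemma computable_add: "computable F \<Longrightarrow> computable G \<Longrightarrow> computable (\<lambda>v. F v + G v)"
  unfolding computable_def by (metis eval.simps(3) regular.simps(3))

lemma computable_shift: "computable F \<Longrightarrow> computable G \<Longrightarrow> computable (\<lambda>v. F v * 2 ^ G v)"
  unfolding computable_def by (metis eval.simps(5) regular.simps(5))

lemma computable_bitop:
  "computable F \<Longrightarrow> computable G \<Longrightarrow> \<not> f False False \<Longrightarrow> computable (\<lambda>v. bitop f (F v) (G v))"
  unfolding computable_def by (metis eval.simps(6) regular.simps(6))

lemma computable_div:
  "computable F \<Longrightarrow> computable G \<Longrightarrow> (\<And>v. G v \<noteq> 0 \<and> G v dvd F v) \<Longrightarrow> computable (\<lambda>v. F v div G v)"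
  unfolding computable_def by (metis eval.simps(4) regular.simps(4))

text \<open>The form in which most divisions enter: exhibiting a computable multiple of the wanted
  function \<open>H\<close> settles exactness once and for all.\<close>

lemma computable_quotient:
  assumes "computable F" "computable G" "\<And>v. G v \<noteq> 0" "\<And>v. F v = H v * G v"
  shows "computable H"
proof -
  have "F v div G v = H v" for v using assms(3)[of v] assms(4)[of v] by simp
  moreover have "computable (\<lambda>v. F v div G v)"
    using assms(1,2) by (rule computable_div) (simp add: assms(3,4))
  ultimately show ?thesis by simp
qed

lemma computable_power2: "computable F \<Longrightarrow> computable (\<lambda>v. 2 ^ F v)"
  using computable_shift[OF computable_const[of 1]] by simp

lemma computable_sum: "(\<And>i. i \<in> I \<Longrightarrow> computable (F i)) \<Longrightarrow> finite I \<Longrightarrow> computable (\<lambda>v. \<Sum>i\<in>I. F i v)"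
  by (induction I rule: infinite_finite_induct) (auto intro: computable_add computable_const)

text \<open>The sparse numbers \<open>z\<^sup>3 + 1\<close> and \<open>z + 1\<close> have the quotient \<open>z\<^sup>2 - z + 1\<close>, which for
  \<open>z = 2 ^ n\<close> contains a run of \<open>n\<close> ones; this is what makes subtraction available.\<close>
lemma computable_mask:
  assumes "computable F"
  shows "computable (\<lambda>v. 2 ^ F v - 1)"
proof -
  let ?z = "\<lambda>v. 2 ^ F v :: nat"
  let ?Q = "\<lambda>v. ?z v * (?z v - 1) + 1"
  have z: "computable ?z" using assms by (rule computable_power2)
  have "computable (\<lambda>v. 2 ^ (F v + F v + F v) + 1)"
    by (intro computable_add computable_power2 computable_const assms)
  moreover have "computable (\<lambda>v. ?z v + 1)"
    by (intro computable_add z computable_const)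
  ultimately have Q: "computable ?Q"
  proof (rule computable_quotient)
    fix v
    obtain y where "?z v = Suc y" using not0_implies_Suc[of "?z v"] by auto
    then show "2 ^ (F v + F v + F v) + 1 = ?Q v * (?z v + 1)"
      by (simp add: power_add algebra_simps)
  qed simp
  \<comment> \<open>\<open>z * (z - 1)\<close> is even, so flipping the lowest bit of
    \<open>?Q\<close> subtracts one; division by \<open>z\<close> then leaves
    \<open>z - 1\<close>.\<close>
  have "xor (?Q v) 1 = (?z v - 1) * ?z v" for v
  proof -
    have "even (?z v * (?z v - 1))" by auto
    then obtain h where h: "?z v * (?z v - 1) = 2 * h" by blast
    have "bitop (\<noteq>) (2 * h + 1) 1 = 2 * h"
      using bitop_rec[of "2 * h + 1" 1 "(\<noteq>)"] bitop_xor[of h 0] by simp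
    then have "xor (2 * h + 1) 1 = 2 * h" by (simp only: bitop_xor)
    then show ?thesis using h by (simp add: mult.commute)
  qed
  moreover have "computable (\<lambda>v. xor (?Q v) 1)"
    unfolding bitop_xor[symmetric] by (intro computable_bitop Q computable_const) simp
  ultimately have "computable (\<lambda>v. (?z v - 1) * ?z v)" by simp
  then show ?thesis by (rule computable_quotient[OF _ z]) auto
qed

text \<open>Two's complement: add the \<open>N\<close>-bit complement of \<open>G\<close> plus one
  and drop the carry. \<open>F + G\<close> is a computable choice of \<open>N\<close> for which both
  numbers have at most \<open>N\<close> bits.\<close>

lemma computable_diff:
  assumes "computable F" "computable G" "\<And>v. G v \<le> F v"
  shows "computable (\<lambda>v. F v - G v)"
proof -
  define N where "N = (\<lambda>v. F v + G v)"
  let ?M = "\<lambda>v. 2 ^ N v - 1 :: nat"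
  have N: "computable N" unfolding N_def by (intro computable_add assms)
  have M: "computable ?M" using N by (rule computable_mask)
  have "computable (\<lambda>v. bitop (\<and>) (F v + bitop (\<lambda>x y. x \<and> \<not> y) (?M v) (G v) + 1) (?M v))"
    by (intro computable_bitop computable_add computable_const assms M) auto
  moreover have "bitop (\<and>) (F v + bitop (\<lambda>x y. x \<and> \<not> y) (?M v) (G v) + 1) (?M v) = F v - G v" for v
  proof -
    have "x < 2 ^ N v" if "x \<le> N v" for x
      using that less_exp le_less_trans by blast
    then have F: "F v < 2 ^ N v" and G: "G v < 2 ^ N v" by (auto simp: N_def)
    have "F v + bitop (\<lambda>x y. x \<and> \<not> y) (?M v) (G v) + 1 = (F v - G v) + 2 ^ N v"
      using mask_minus_nat[OF G] assms(3)[of v] G by simp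
    moreover have "and x (?M v) = x mod 2 ^ N v" for x
      by (metis mask_nat_def take_bit_eq_mask take_bit_nat_def)
    ultimately show ?thesis using F by (simp add: bitop_and)
  qed
  ultimately show ?thesis by simp
qed

subsection \<open>Vectors packed into numbers\<close>

text \<open>No bound on the entries is built in: the linear identities hold even if entries overflow
  their fields, and only the bitwise and size facts ask for small entries.\<close>

definition vec :: "nat \<Rightarrow> nat \<Rightarrow> (nat \<Rightarrow> nat) \<Rightarrow> nat" where
  "vec W M g = (\<Sum>p<M. g p * 2 ^ (W * p))"

lemma vec_cong: "(\<And>p. p < M \<Longrightarrow> g p = h p) \<Longrightarrow> vec W M g = vec W M h"
  by (simp add: vec_def)

lemma vec_Suc: "vec W (Suc M) g = vec W M g + 2 ^ (W * M) * g M"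
  by (simp add: vec_def)

lemma vec_add: "vec W M g + vec W M h = vec W M (\<lambda>p. g p + h p)"
  by (simp add: vec_def sum.distrib algebra_simps)

lemma vec_scale: "vec W M (\<lambda>p. a * g p) = a * vec W M g"
  by (simp add: vec_def sum_distrib_left algebra_simps)

lemma vec_less: "(\<And>p. p < M \<Longrightarrow> g p < 2 ^ W) \<Longrightarrow> vec W M g < 2 ^ (W * M)"
proof (induction M)
  case 0
  then show ?case by (simp add: vec_def)
next
  case (Suc M)
  have "vec W (Suc M) g < 2 ^ (W * M) + 2 ^ (W * M) * g M"
    using Suc by (simp add: vec_Suc)
  also have "\<dots> = 2 ^ (W * M) * Suc (g M)" by simp
  also have "\<dots> \<le> 2 ^ (W * M) * 2 ^ W"
    using Suc.prems[of M] by (intro mult_le_mono2) simp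
  finally show ?case by (simp add: power_add mult.commute)
qed

lemma bitop_vec:
  assumes "\<not> f False False" "\<And>p. p < M \<Longrightarrow> g p < 2 ^ W \<and> h p < 2 ^ W"
  shows "bitop f (vec W M g) (vec W M h) = vec W M (\<lambda>p. bitop f (g p) (h p))"
  using assms(2)
proof (induction M)
  case 0
  then show ?case by (simp add: vec_def)
next
  case (Suc M)
  have "vec W M g < 2 ^ (W * M)" "vec W M h < 2 ^ (W * M)"
    using Suc.prems by (auto intro!: vec_less)
  then show ?case
    using Suc bitop_append[where f = f, OF assms(1)] by (simp add: vec_Suc)
qed

lemma sum_lessThan_add: "sum t {..<a + b} = sum t {..<a} + (\<Sum>p<b. t (a + p))"
  for t :: "nat \<Rightarrow> nat"
  by (induction b) simp_all

text \<open>Position \<open>q * n + x\<close> has weight \<open>(W * n) * q + W * x\<close>, so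
  \<open>n\<close> adjacent fields may be read as one field of width \<open>W * n\<close>.\<close>

lemma vec_product:
  "vec W (M * n) (\<lambda>p. g (p div n) (p mod n)) = vec (W * n) M (\<lambda>q. vec W n (g q))"
proof (induction M)
  case 0
  then show ?case by (simp add: vec_def)
next
  case (Suc M)
  let ?t = "\<lambda>p. g (p div n) (p mod n) * 2 ^ (W * p)"
  have "vec W (Suc M * n) (\<lambda>p. g (p div n) (p mod n)) = sum ?t {..<M * n + n}"
    by (simp add: vec_def add.commute)
  also have "\<dots> = sum ?t {..<M * n} + (\<Sum>p<n. ?t (M * n + p))"
    by (rule sum_lessThan_add)
  also have "(\<Sum>p<n. ?t (M * n + p)) = 2 ^ (W * n * M) * vec W n (g M)"
    unfolding vec_def sum_distrib_left
    by (rule sum.cong) (auto simp: power_add algebra_simps)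
  finally show ?case using Suc by (simp add: vec_Suc) (simp add: vec_def)
qed

lemma vec_const_1: "vec W n (\<lambda>_. 1) * (2 ^ W - 1) = 2 ^ (W * n) - 1"
proof (induction n)
  case 0
  then show ?case by (simp add: vec_def)
next
  case (Suc n)
  have "vec W (Suc n) (\<lambda>_. 1) * (2 ^ W - 1) = 2 ^ (W * n) - 1 + 2 ^ (W * n) * (2 ^ W - 1)"
    using Suc by (simp add: vec_Suc algebra_simps)
  also have "\<dots> = 2 ^ (W * n) * 2 ^ W - 1"
    by (simp add: diff_mult_distrib2)
  finally show ?case by (simp add: power_add mult.commute)
qed

text \<open>Summation by parts for the series \<open>x * z ^ x\<close> with
  \<open>z = 2 ^ W\<close>. The geometric sum stands on the left to avoid a subtraction;
  \<open>n = 0\<close> is separate because \<open>n - 1\<close> truncates.\<close>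

lemma vec_id: "vec W n (\<lambda>x. x) * (2 ^ W - 1) + vec W n (\<lambda>_. 1) = (n - 1) * 2 ^ (W * n) + (if n = 0 then 0 else 1)"
proof (induction n)
  case 0
  then show ?case by (simp add: vec_def)
next
  case (Suc n)
  obtain y where y: "(2::nat) ^ W = Suc y" using not0_implies_Suc[of "2 ^ W"] by auto
  show ?case
  proof (cases n)
    case 0
    then show ?thesis by (simp add: vec_def)
  next
    case (Suc m)
    then show ?thesis using \<open>vec W n (\<lambda>x. x) * (2 ^ W - 1) + _ = _\<close>
      by (simp add: vec_Suc power_add y algebra_simps)
  qed
qed

section \<open>Multiplication by geometric sums, and the fieldwise test for zero\<close>

lemma power2_power2_minus_1: "(2::nat) ^ 2 ^ n - 1 \<noteq> 0"
  using less_exp[of "2 ^ n"] one_le_power[of "2::nat" n] by linarith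

lemma computable_times_vec_1:
  assumes "computable F" "computable w" "computable m"
  shows "computable (\<lambda>v. F v * vec (2 ^ w v) (2 ^ m v) (\<lambda>_. 1))"
proof -
  have "computable (\<lambda>v. F v * 2 ^ (2 ^ (w v + m v)) - F v)"
    by (intro computable_diff computable_shift computable_power2 computable_add assms) simp
  moreover have "computable (\<lambda>v. 2 ^ (2 ^ w v) - 1)"
    by (intro computable_mask computable_power2 assms)
  ultimately show ?thesis
  proof (rule computable_quotient)
    show "F v * 2 ^ 2 ^ (w v + m v) - F v
        = F v * vec (2 ^ w v) (2 ^ m v) (\<lambda>_. 1) * (2 ^ 2 ^ w v - 1)" for v
      using vec_const_1[of "2 ^ w v" "2 ^ m v"]
      by (metis (no_types, lifting) mult.assoc power_add diff_mult_distrib2 nat_mult_1_right)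
    show "(2::nat) ^ 2 ^ w v - 1 \<noteq> 0" for v
      using power2_power2_minus_1 by blast
  qed
qed

text \<open>This is \<open>vec_id\<close> multiplied by \<open>F\<close> and solved for its first
  summand; with \<open>n = 2 ^ m\<close> the factor \<open>n - 1\<close> turns into a shift and a
  subtraction.\<close>

lemma computable_times_vec_id:
  assumes "computable F" "computable w" "computable m"
  shows "computable (\<lambda>v. F v * vec (2 ^ w v) (2 ^ m v) (\<lambda>x. x))"
proof -
  let ?N = "\<lambda>v. (F v * 2 ^ m v - F v) * 2 ^ (2 ^ (w v + m v)) + F v"
  let ?V = "\<lambda>v. F v * vec (2 ^ w v) (2 ^ m v) (\<lambda>x. x) * (2 ^ 2 ^ w v - 1)"
  have eq: "?V v + F v * vec (2 ^ w v) (2 ^ m v) (\<lambda>_. 1) = ?N v" for v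
  proof -
    have "?V v + F v * vec (2 ^ w v) (2 ^ m v) (\<lambda>_. 1) =
        F v * (vec (2 ^ w v) (2 ^ m v) (\<lambda>x. x) * (2 ^ 2 ^ w v - 1) + vec (2 ^ w v) (2 ^ m v) (\<lambda>_. 1))"
      by (simp add: algebra_simps)
    also have "\<dots> = ?N v"
      unfolding vec_id by (simp add: diff_mult_distrib2 diff_mult_distrib power_add algebra_simps)
    finally show ?thesis .
  qed
  have le: "F v * vec (2 ^ w v) (2 ^ m v) (\<lambda>_. 1) \<le> ?N v" for v
    using eq[of v] by linarith
  have "computable (\<lambda>v. ?N v - F v * vec (2 ^ w v) (2 ^ m v) (\<lambda>_. 1))"
    by (intro computable_diff computable_times_vec_1 computable_add computable_shift computable_power2 assms le)
      simp
  moreover have "computable (\<lambda>v. 2 ^ (2 ^ w v) - 1)"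
    by (intro computable_mask computable_power2 assms)
  ultimately show ?thesis
    by (rule computable_quotient) (use power2_power2_minus_1 in blast, simp flip: eq)
qed

lemma and_power2: "and x (2 ^ n) = 2 ^ n * of_bool (bit x n)" for x :: nat
  by (rule bit_eqI) (auto simp: bit_and_iff bit_exp_iff)

text \<open>Adding \<open>2 ^ (W - 1) - 1\<close> to a field of width \<open>W\<close> sets its top
  bit exactly when the entry is nonzero. The entries leave the top bit free, so nothing carries into
  the next field. Masking and an exact division bring the top bits down.\<close>

lemma computable_nonzero:
  assumes T: "computable (\<lambda>v. vec (2 ^ w v) (2 ^ m v) (g v))"
    and w: "computable w" and m: "computable m"
    and g: "\<And>v p. p < 2 ^ m v \<Longrightarrow> g v p < 2 ^ (2 ^ w v - 1)"
  shows "computable (\<lambda>v. vec (2 ^ w v) (2 ^ m v) (\<lambda>p. of_bool (g v p \<noteq> 0)))"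
proof -
  let ?h = "\<lambda>v. 2 ^ (2 ^ w v - 1) :: nat"
  have h: "computable ?h"
    by (intro computable_power2 computable_mask w)
  have one: "computable (\<lambda>v. F v * vec (2 ^ w v) (2 ^ m v) (\<lambda>_. 1))" if "computable F" for F
    by (intro computable_times_vec_1 that w m)
  have "computable (\<lambda>v. bitop (\<and>) (vec (2 ^ w v) (2 ^ m v) (g v) + (?h v - 1) * vec (2 ^ w v) (2 ^ m v) (\<lambda>_. 1))
      (?h v * vec (2 ^ w v) (2 ^ m v) (\<lambda>_. 1)))"
    by (intro computable_bitop computable_add T one computable_mask h w) simp
  then show ?thesis
  proof (rule computable_quotient[OF _ h])
    fix v
    let ?W = "2 ^ w v" and ?M = "2 ^ m v"
    have H: "2 ^ ?W = 2 * ?h v" by (simp flip: power_Suc)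
    have "bitop (\<and>) (vec ?W ?M (g v) + (?h v - 1) * vec ?W ?M (\<lambda>_. 1)) (?h v * vec ?W ?M (\<lambda>_. 1))
      = bitop (\<and>) (vec ?W ?M (\<lambda>p. g v p + (?h v - 1))) (vec ?W ?M (\<lambda>p. ?h v))"
      by (simp add: vec_add flip: vec_scale)
    also have "\<dots> = vec ?W ?M (\<lambda>p. bitop (\<and>) (g v p + (?h v - 1)) (?h v))"
    proof (rule bitop_vec)
      fix p :: nat assume "p < ?M"
      from g[OF this] show "g v p + (?h v - 1) < 2 ^ ?W \<and> ?h v < 2 ^ ?W"
        unfolding H by simp
    qed simp
    also have "\<dots> = vec ?W ?M (\<lambda>p. ?h v * of_bool (g v p \<noteq> 0))"
    proof (rule vec_cong)
      fix p :: nat assume "p < ?M"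
      from g[OF this] have gp: "g v p < ?h v" .
      have "bitop (\<and>) (g v p + (?h v - 1)) (?h v)
          = ?h v * of_bool (odd ((g v p + (?h v - 1)) div ?h v))"
        by (simp add: bitop_and and_power2 bit_iff_odd)
      also have "(g v p + (?h v - 1)) div ?h v = of_bool (g v p \<noteq> 0)"
      proof (cases "g v p = 0")
        case False
        then have "g v p + (?h v - 1) = (g v p - 1) + ?h v" by simp
        then have "(g v p + (?h v - 1)) div ?h v = (g v p - 1) div ?h v + 1"
          by (metis div_add_self2 power_not_zero zero_neq_numeral)
        also have "(g v p - 1) div ?h v = 0" using gp by simp
        finally show ?thesis using False by simp
      qed simp
      finally show "bitop (\<and>) (g v p + (?h v - 1)) (?h v) = ?h v * of_bool (g v p \<noteq> 0)" by simp
    qed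
    finally show "bitop (\<and>) (vec ?W ?M (g v) + (?h v - 1) * vec ?W ?M (\<lambda>_. 1)) (?h v * vec ?W ?M (\<lambda>_. 1))
      = vec ?W ?M (\<lambda>p. of_bool (g v p \<noteq> 0)) * ?h v"
      by (simp only: vec_scale mult.commute[of _ "?h v"])
  qed simp
qed

subsection \<open>Truth tables of bounded formulas\<close>

text \<open>Variables are de Bruijn levels: a quantifier below \<open>d\<close> free variables binds variable \<open>d\<close>.
  An atom equates two sums of square-free monomials, each given by its set of variables.\<close>
datatype cfm = CAtom "nat set list" "nat set list" | CNeg cfm | CAnd cfm cfm | CEx cfm

text \<open>A product over all \<open>i < d\<close> rather than over \<open>J\<close>, so that each
  new level appends one factor; the empty set denotes the constant 1.\<close>

definition monomial :: "nat set \<Rightarrow> nat \<Rightarrow> (nat \<Rightarrow> nat) \<Rightarrow> nat" where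
  "monomial J d e = (\<Prod>i<d. if i \<in> J then e i else 1)"

text \<open>The quantifier ranges \<open>X\<close> are a parameter: \<open>UNIV\<close> gives the
  intended semantics and \<open>box c\<close> the bounded one that truth tables can
  represent.\<close>

fun csat :: "(nat \<Rightarrow> nat set) \<Rightarrow> nat \<Rightarrow> (nat \<Rightarrow> nat) \<Rightarrow> cfm \<Rightarrow> bool" where
  "csat X d e (CAtom l r) = ((\<Sum>J\<leftarrow>l. monomial J d e) = (\<Sum>J\<leftarrow>r. monomial J d e))"
| "csat X d e (CNeg p) = (\<not> csat X d e p)"
| "csat X d e (CAnd p q) = (csat X d e p \<and> csat X d e q)"
| "csat X d e (CEx p) = (\<exists>x\<in>X d. csat X (Suc d) (e(d := x)) p)"

fun depth :: "cfm \<Rightarrow> nat" where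
  "depth (CAtom l r) = 0"
| "depth (CNeg p) = depth p"
| "depth (CAnd p q) = max (depth p) (depth q)"
| "depth (CEx p) = Suc (depth p)"

fun width :: "cfm \<Rightarrow> nat" where
  "width (CAtom l r) = max (length l) (length r)"
| "width (CNeg p) = width p"
| "width (CAnd p q) = max (width p) (width q)"
| "width (CEx p) = width p"

abbreviation box :: "(nat \<Rightarrow> nat) \<Rightarrow> nat \<Rightarrow> nat set" where
  "box c i \<equiv> {..<2 ^ c i}"

text \<open>With \<open>d\<close> free variables, truth tables have fields of \<open>2 ^ field_log K B c d\<close> bits. A field at level
  \<open>d\<close> consists of \<open>2 ^ c d\<close> fields of level \<open>Suc d\<close>, so an existential quantifier over variable \<open>d\<close> is
  the test which of the wide fields are nonzero.\<close>
definition field_log :: "nat \<Rightarrow> nat \<Rightarrow> (nat \<Rightarrow> nat) \<Rightarrow> nat \<Rightarrow> nat" where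
  "field_log K B c d = B + 1 + sum c {..<K} + sum c {d..<K}"

text \<open>Mixed radix decoding of a table position. The variable bound last is the fastest digit,
  so its values occupy adjacent fields.\<close>

fun point :: "(nat \<Rightarrow> nat) \<Rightarrow> nat \<Rightarrow> nat \<Rightarrow> nat \<Rightarrow> nat" where
  "point c 0 p = (\<lambda>_. 0)"
| "point c (Suc d) p = (point c d (p div 2 ^ c d))(d := p mod 2 ^ c d)"

lemma point_less: "i < d \<Longrightarrow> point c d p i < 2 ^ c i"
  by (induction d arbitrary: p) (auto simp: less_Suc_eq)

definition table :: "nat \<Rightarrow> nat \<Rightarrow> (nat \<Rightarrow> nat) \<Rightarrow> nat \<Rightarrow> ((nat \<Rightarrow> nat) \<Rightarrow> nat) \<Rightarrow> nat" where
  "table K B c d g = vec (2 ^ field_log K B c d) (2 ^ sum c {..<d}) (\<lambda>p. g (point c d p))"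

text \<open>Both sides are the same number: the fields of level \<open>Suc d\<close> that share the
  first \<open>d\<close> variables fill exactly one field of level \<open>d\<close>.\<close>

lemma table_Suc:
  assumes "d < K"
  shows "table K B c (Suc d) g = vec (2 ^ field_log K B c d) (2 ^ sum c {..<d})
    (\<lambda>q. vec (2 ^ field_log K B c (Suc d)) (2 ^ c d) (\<lambda>x. g ((point c d q)(d := x))))"
proof -
  have "sum c {d..<K} = c d + sum c {Suc d..<K}"
    using assms by (rule sum.atLeast_Suc_lessThan)
  then have W: "2 ^ field_log K B c (Suc d) * 2 ^ c d = (2 ^ field_log K B c d :: nat)"
    by (simp add: field_log_def flip: power_add)
  have "2 ^ sum c {..<Suc d} = 2 ^ sum c {..<d} * (2 ^ c d :: nat)"
    by (simp add: power_add)
  then show ?thesis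
    unfolding table_def
    using vec_product[of "2 ^ field_log K B c (Suc d)" "2 ^ sum c {..<d}" "2 ^ c d"
        "\<lambda>q x. g ((point c d q)(d := x))"]
    by (simp add: W)
qed

lemma monomial_Suc: "monomial J (Suc d) (e(d := x)) = monomial J d e * (if d \<in> J then x else 1)"
proof -
  have "monomial J d (e(d := x)) = monomial J d e"
    unfolding monomial_def by (rule prod.cong) auto
  then show ?thesis by (simp add: monomial_def)
qed

lemma computable_field_log: "computable (\<lambda>v. field_log K B (\<lambda>i. v (Suc i)) d)"
  unfolding field_log_def
  by (intro computable_add computable_const computable_sum computable_var) auto

lemma computable_sum_vars: "computable (\<lambda>v. \<Sum>i<d. v (Suc i))"
  by (intro computable_sum computable_var) auto

text \<open>An outer product: the table of level \<open>d\<close> times the packed values of the new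
  variable is the table of level \<open>Suc d\<close>. A new variable outside \<open>J\<close>
  contributes a vector of ones instead.\<close>

lemma computable_table_monomial:
  assumes "d \<le> K"
  shows "computable (\<lambda>v. table K B (\<lambda>i. v (Suc i)) d (monomial J d))"
  using assms
proof (induction d)
  case 0
  have "table K B c 0 (monomial J 0) = 1" for c
    by (simp add: table_def vec_def monomial_def)
  then show ?case by (simp add: computable_const)
next
  case (Suc d)
  let ?h = "\<lambda>x. if d \<in> J then x else 1"
  have "table K B c (Suc d) (monomial J (Suc d)) =
      table K B c d (monomial J d) * vec (2 ^ field_log K B c (Suc d)) (2 ^ c d) ?h" for c
  proof -
    let ?V = "vec (2 ^ field_log K B c (Suc d)) (2 ^ c d) ?h"
    have "table K B c (Suc d) (monomial J (Suc d)) =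
        vec (2 ^ field_log K B c d) (2 ^ sum c {..<d}) (\<lambda>q. ?V * monomial J d (point c d q))"
      using Suc.prems by (simp only: table_Suc Suc_le_eq monomial_Suc vec_scale mult.commute[of ?V])
    then show ?thesis by (simp only: vec_scale table_def mult.commute[of _ ?V])
  qed
  moreover have "computable (\<lambda>v. table K B (\<lambda>i. v (Suc i)) d (monomial J d) *
      vec (2 ^ field_log K B (\<lambda>i. v (Suc i)) (Suc d)) (2 ^ v (Suc d)) ?h)"
    using Suc
    by (cases "d \<in> J")
      (simp_all add: computable_times_vec_1[simplified] computable_times_vec_id computable_field_log computable_var)
  ultimately show ?case by simp
qed

lemma computable_table_sum:
  assumes "d \<le> K"
  shows "computable (\<lambda>v. table K B (\<lambda>i. v (Suc i)) d (\<lambda>e. \<Sum>J\<leftarrow>l. monomial J d e))"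
proof (induction l)
  case Nil
  then show ?case by (simp add: table_def vec_def computable_const)
next
  case (Cons J l)
  then show ?case
    using computable_add[OF computable_table_monomial[OF assms, of B J] Cons]
    by (simp add: table_def vec_add)
qed

lemma monomial_le: "monomial J d (point c d p) \<le> 2 ^ sum c {..<d}"
proof -
  have "monomial J d (point c d p) \<le> (\<Prod>i<d. 2 ^ c i)"
    unfolding monomial_def
    by (rule prod_mono) (auto simp: less_imp_le[OF point_less])
  then show ?thesis by (simp add: power_sum)
qed

text \<open>There are at most \<open>B < 2 ^ B\<close> monomials, each at most
  \<open>2 ^ sum c {..<d}\<close>; the part \<open>B + 1 + sum c {..<K}\<close> of
  \<open>field_log\<close> pays for this. The exponent keeps the top bit free for
  \<open>computable_nonzero\<close>.\<close>

lemma sum_monomials_less: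
  assumes "d \<le> K" "length l \<le> B"
  shows "(\<Sum>J\<leftarrow>l. monomial J d (point c d p)) < 2 ^ (2 ^ field_log K B c d - 1)"
proof -
  let ?S = "sum c {..<d}"
  have "(\<Sum>J\<leftarrow>l. monomial J d (point c d p)) \<le> length l * 2 ^ ?S"
  proof (induction l)
    case (Cons J l)
    then show ?case using monomial_le[of J d c p] by simp
  qed simp
  also have "\<dots> \<le> B * 2 ^ ?S" using assms(2) by simp
  also have "\<dots> < 2 ^ B * 2 ^ ?S" using less_exp[of B] by simp
  also have "\<dots> = 2 ^ (B + ?S)" by (simp add: power_add)
  also have "\<dots> \<le> 2 ^ (2 ^ field_log K B c d - 1)"
  proof (rule power_increasing)
    have "?S \<le> sum c {..<K}" using assms(1) by (intro sum_mono2) auto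
    then have "Suc (B + ?S) \<le> field_log K B c d" by (simp add: field_log_def)
    also have "\<dots> < 2 ^ field_log K B c d" by (rule less_exp)
    finally show "B + ?S \<le> 2 ^ field_log K B c d - 1" by simp
  qed simp
  finally show ?thesis .
qed

text \<open>Fields of at least two bits that hold only 0 or 1 leave the top bit of the merged field
  clear, so that \<open>computable_nonzero\<close> also applies to merged fields.\<close>

lemma vec_of_bool_less:
  assumes "W \<ge> 2" "\<And>x. g x \<le> 1"
  shows "vec W n g < 2 ^ (W * n - 1)"
proof (cases "n = 0")
  case True
  then show ?thesis by (simp add: vec_def)
next
  case False
  have "(4::nat) \<le> 2 ^ W" using power_increasing[OF assms(1), of "2::nat"] by simp
  then have "vec W n (\<lambda>_. 1) * 2 \<le> vec W n (\<lambda>_. 1) * (2 ^ W - 1)"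
    by (intro mult_le_mono2) simp
  also have "\<dots> < 2 ^ (W * n)" by (simp only: vec_const_1) simp
  also have "\<dots> = 2 ^ (W * n - 1) * 2"
    using False assms(1) by (simp flip: power_Suc2)
  finally have "vec W n (\<lambda>_. 1) < 2 ^ (W * n - 1)" by simp
  moreover have "vec W n g \<le> vec W n (\<lambda>_. 1)"
    unfolding vec_def by (intro sum_mono mult_le_mono1 assms(2))
  ultimately show ?thesis by simp
qed

lemma xor_nat_less:
  fixes a b :: nat
  assumes "a < 2 ^ n" "b < 2 ^ n"
  shows "xor a b < 2 ^ n"
  using assms by (metis take_bit_nat_eq_self_iff take_bit_xor)

lemma xor_nat_eq_0_iff: "xor a b = 0 \<longleftrightarrow> a = b" for a b :: nat
  by (auto simp: bit_eq_iff bit_xor_iff)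

lemma of_bool_less_power2_power2: "of_bool P < (2::nat) ^ 2 ^ n"
  using power2_power2_minus_1[of n] by (cases P) auto

lemma computable_table_truth:
  assumes "d + depth p \<le> K" "width p \<le> B"
  shows "computable (\<lambda>v. table K B (\<lambda>i. v (Suc i)) d
    (\<lambda>e. of_bool (csat (box (\<lambda>i. v (Suc i))) d e p)))"
  using assms
proof (induction p arbitrary: d)
  have bitop_table: "bitop f (table K B c d g) (table K B c d h) = table K B c d (\<lambda>e. bitop f (g e) (h e))"
    if "\<not> f False False"
      "\<And>p. g (point c d p) < 2 ^ 2 ^ field_log K B c d" "\<And>p. h (point c d p) < 2 ^ 2 ^ field_log K B c d"
    for f c d g h
    unfolding table_def by (rule bitop_vec) (use that in auto)
  have one: "computable (\<lambda>v. table K B (\<lambda>i. v (Suc i)) d (\<lambda>_. 1))" for d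
    using computable_times_vec_1[OF computable_const[of 1] computable_field_log computable_sum_vars]
    by (simp add: table_def)
  have neg: "computable (\<lambda>v. table K B (\<lambda>i. v (Suc i)) d (\<lambda>e. of_bool (\<not> Q v e)))"
    if "computable (\<lambda>v. table K B (\<lambda>i. v (Suc i)) d (\<lambda>e. of_bool (Q v e)))" for Q d
  proof -
    have "bitop (\<noteq>) (of_bool P) 1 = of_bool (\<not> P)" for P
      unfolding bitop_xor by (cases P) simp_all
    then have "bitop (\<noteq>) (table K B c d (\<lambda>e. of_bool (Q v e))) (table K B c d (\<lambda>_. 1))
        = table K B c d (\<lambda>e. of_bool (\<not> Q v e))" for c v
      using of_bool_less_power2_power2[of True] by (subst bitop_table) (auto simp: of_bool_less_power2_power2)
    then show ?thesis
      using computable_bitop[OF that one[of d], of "(\<noteq>)"] by simp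
  qed
  {
    case (CAtom l r)
    let ?s = "\<lambda>l e. \<Sum>J\<leftarrow>l. monomial J d e"
    have half: "(2::nat) ^ (2 ^ n - 1) \<le> 2 ^ 2 ^ n" for n
      by (rule power_increasing) auto
    have l: "?s l (point c d p) < 2 ^ (2 ^ field_log K B c d - 1)"
      and r: "?s r (point c d p) < 2 ^ (2 ^ field_log K B c d - 1)" for c p
      by (rule sum_monomials_less; use CAtom.prems in simp)+
    have "bitop (\<noteq>) (table K B c d (?s l)) (table K B c d (?s r))
        = table K B c d (\<lambda>e. xor (?s l e) (?s r e))" for c
      using less_le_trans[OF l half] less_le_trans[OF r half] 
      by (subst bitop_table) (simp, simp, simp, simp only: bitop_xor)
    then have "computable (\<lambda>v. table K B (\<lambda>i. v (Suc i)) d (\<lambda>e. xor (?s l e) (?s r e)))"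
      using computable_bitop[OF computable_table_sum[of d K B l] computable_table_sum[of d K B r], of "(\<noteq>)"]
        CAtom.prems by simp
    then have "computable (\<lambda>v. table K B (\<lambda>i. v (Suc i)) d (\<lambda>e. of_bool (xor (?s l e) (?s r e) \<noteq> 0)))"
      unfolding table_def
      by (rule computable_nonzero[OF _ computable_field_log computable_sum_vars xor_nat_less[OF l r]])
    from neg[OF this] show ?case by (simp add: xor_nat_eq_0_iff)
  next
    case (CNeg p)
    then show ?case using neg by simp
  next
    case (CAnd p q)
    have "bitop (\<and>) (of_bool P) (of_bool Q) = of_bool (P \<and> Q)" for P Q
      unfolding bitop_and by (cases P; cases Q) simp_all
    then have "bitop (\<and>) (table K B c d (\<lambda>e. of_bool (P e))) (table K B c d (\<lambda>e. of_bool (Q e)))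
        = table K B c d (\<lambda>e. of_bool (P e \<and> Q e))" for c P Q
      by (subst bitop_table) (auto simp: of_bool_less_power2_power2)
    then show ?case
      using computable_bitop[OF CAnd.IH(1)[of d] CAnd.IH(2)[of d], of "(\<and>)"] CAnd.prems by simp
  next
    case (CEx p)
    let ?c = "\<lambda>v i. v (Suc i) :: nat"
    let ?g = "\<lambda>v q. vec (2 ^ field_log K B (?c v) (Suc d)) (2 ^ ?c v d)
      (\<lambda>x. of_bool (csat (box (?c v)) (Suc d) ((point (?c v) d q)(d := x)) p))"
    have d: "d < K" using CEx.prems by simp
    \<comment> \<open>The table of \<open>p\<close> is reread at level \<open>d\<close>: entry
      \<open>q\<close> collects the truth values of \<open>p\<close> for all values of variable
      \<open>d\<close> and is nonzero exactly if a witness exists.\<close>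
    have "computable (\<lambda>v. vec (2 ^ field_log K B (?c v) d) (2 ^ sum (?c v) {..<d}) (?g v))"
      using CEx.IH[of "Suc d"] CEx.prems by (simp add: table_Suc[OF d])
    then have "computable (\<lambda>v. vec (2 ^ field_log K B (?c v) d) (2 ^ sum (?c v) {..<d}) (\<lambda>q. of_bool (?g v q \<noteq> 0)))"
    proof (rule computable_nonzero)
      fix v q
      have "sum (?c v) {d..<K} = ?c v d + sum (?c v) {Suc d..<K}"
        using d by (rule sum.atLeast_Suc_lessThan)
      then have W: "2 ^ field_log K B (?c v) (Suc d) * 2 ^ ?c v d = (2 ^ field_log K B (?c v) d :: nat)"
        by (simp add: field_log_def flip: power_add)
      have "(2::nat) \<le> 2 ^ field_log K B (?c v) (Suc d)"
        by (simp add: field_log_def)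
      from vec_of_bool_less[OF this] show "?g v q < 2 ^ (2 ^ field_log K B (?c v) d - 1)"
        unfolding W[symmetric] by simp
    qed (auto intro: computable_field_log computable_sum_vars)
    moreover have "?g v q \<noteq> 0 \<longleftrightarrow> csat (box (?c v)) d (point (?c v) d q) (CEx p)" for v q
      by (auto simp: vec_def)
    ultimately show ?case by (simp only: table_def)
  }
qed

text \<open>The table over variable 0 has an entry for the input only if the input lies below
  \<open>2 ^ v 1\<close>. The position of that entry is a shift of \<open>v 0\<close>, because the
  width is a power of two.\<close>

lemma computable_truth:
  assumes "1 + depth p \<le> K"
  shows "\<exists>F. computable F \<and> (\<forall>v. v 0 < 2 ^ v 1 \<longrightarrow>
    F v = of_bool (csat (box (\<lambda>i. v (Suc i))) 1 ((\<lambda>_. 0)(0 := v 0)) p))"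
proof -
  let ?c = "\<lambda>v i. v (Suc i) :: nat"
  let ?W = "\<lambda>v. field_log K (width p) (?c v) 1"
  let ?t = "\<lambda>v q. of_bool (csat (box (?c v)) 1 (point (?c v) 1 q) p) :: nat"
  let ?T = "\<lambda>v. vec (2 ^ ?W v) (2 ^ v 1) (?t v)"
  have T: "computable ?T"
    using computable_table_truth[OF assms order_refl] by (simp add: table_def)
  have s: "computable (\<lambda>v. 2 ^ (v 0 * 2 ^ ?W v))"
    by (intro computable_power2 computable_shift computable_var computable_field_log)
  have "computable (\<lambda>v. bitop (\<and>) (?T v) (2 ^ (v 0 * 2 ^ ?W v)))"
    using T s by (rule computable_bitop) simp
  then have F: "computable (\<lambda>v. of_bool (bit (?T v) (v 0 * 2 ^ ?W v)))"
    by (rule computable_quotient[OF _ s]) (simp_all add: bitop_and and_power2)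
  moreover have "of_bool (bit (?T v) (v 0 * 2 ^ ?W v)) = ?t v (v 0)" if "v 0 < 2 ^ v 1" for v
  proof -
    let ?s = "2 ^ (2 ^ ?W v * v 0) :: nat"
    have unit: "vec W M (\<lambda>q. a * of_bool (q = k)) = a * 2 ^ (W * k)" if "k < M" for W M k a
      using that by (simp add: vec_def if_distrib if_distribR of_bool_def cong: if_cong)
    \<comment> \<open>Isolating one bit is a conjunction with the unit vector of field
      \<open>v 0\<close>, which makes \<open>bitop_vec\<close> applicable.\<close>
    have "?s * of_bool (bit (?T v) (2 ^ ?W v * v 0)) = bitop (\<and>) (?T v) (vec (2 ^ ?W v) (2 ^ v 1) (\<lambda>q. of_bool (q = v 0)))"
      using unit[OF that, of "2 ^ ?W v" 1] by (simp add: bitop_and and_power2)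
    also have "\<dots> = vec (2 ^ ?W v) (2 ^ v 1) (\<lambda>q. bitop (\<and>) (?t v q) (of_bool (q = v 0)))"
      by (rule bitop_vec) (simp_all only: of_bool_less_power2_power2, simp)
    also have "\<dots> = vec (2 ^ ?W v) (2 ^ v 1) (\<lambda>q. ?t v (v 0) * of_bool (q = v 0))"
      by (rule vec_cong) (auto simp: bitop_and)
    also have "\<dots> = ?t v (v 0) * ?s" by (rule unit[OF that])
    finally have "of_bool (bit (?T v) (2 ^ ?W v * v 0)) = ?t v (v 0)" by simp
    then show ?thesis by (simp only: mult.commute)
  qed
  moreover have "point (?c v) 1 (v 0) = (\<lambda>_. 0)(0 := v 0)" if "v 0 < 2 ^ v 1" for v
    using that by simp
  ultimately show ?thesis
    by (intro exI[of _ "\<lambda>v. of_bool (bit (?T v) (v 0 * 2 ^ ?W v))"]) simp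
qed

subsection \<open>Almost-all quantifiers and ALS sets\<close>

text \<open>For almost all values of entry \<open>i\<close>, for almost all values of entry \<open>i + 1\<close>, and so on for \<open>r\<close>
  entries: this is what quantification over an ALS set amounts to.\<close>
fun almost_all :: "nat \<Rightarrow> nat \<Rightarrow> ((nat \<Rightarrow> nat) \<Rightarrow> bool) \<Rightarrow> (nat \<Rightarrow> nat) \<Rightarrow> bool" where
  "almost_all 0 i P c = P c"
| "almost_all (Suc r) i P c = (\<exists>m. \<forall>x\<ge>m. almost_all r (Suc i) P (c(i := x)))"

text \<open>The quantifiers leave entries below \<open>i\<close> alone, so the implication may use
  that they agree with \<open>c\<close>.\<close>

lemma almost_all_mono:
  assumes "almost_all r i P c" "\<And>c'. \<forall>j<i. c' j = c j \<Longrightarrow> P c' \<Longrightarrow> Q c'"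
  shows "almost_all r i Q c"
  using assms
proof (induction r arbitrary: i c)
  case (Suc r)
  then obtain m where m: "\<And>x. x \<ge> m \<Longrightarrow> almost_all r (Suc i) P (c(i := x))" by auto
  have "almost_all r (Suc i) Q (c(i := x))" if "x \<ge> m" for x
    by (rule Suc.IH[OF m[OF that]]) (use Suc.prems(2) in auto)
  then show ?case by auto
qed simp

lemma almost_all_trivial: "(\<And>c. P c) \<Longrightarrow> almost_all r i P c"
  by (induction r arbitrary: i c) auto

lemma almost_all_conj:
  assumes "almost_all r i P c" "almost_all r i Q c"
  shows "almost_all r i (\<lambda>c. P c \<and> Q c) c"
  using assms
proof (induction r arbitrary: i c)
  case (Suc r)
  then obtain m n where m: "\<And>x. x \<ge> m \<Longrightarrow> almost_all r (Suc i) P (c(i := x))"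
    and n: "\<And>x. x \<ge> n \<Longrightarrow> almost_all r (Suc i) Q (c(i := x))" by auto
  have "almost_all r (Suc i) (\<lambda>c. P c \<and> Q c) (c(i := x))" if "max m n \<le> x" for x
    by (rule Suc.IH[OF m n]) (use that in simp_all)
  then show ?case unfolding almost_all.simps by blast
qed simp

lemma almost_all_cong:
  assumes "\<And>A B. \<forall>j<i + r. A j = B j \<Longrightarrow> P A = P B" "\<forall>j<i. c j = c' j"
  shows "almost_all r i P c = almost_all r i P c'"
  using assms
proof (induction r arbitrary: i c c')
  case 0
  then show ?case by simp
next
  case (Suc r)
  have "almost_all r (Suc i) P (c(i := x)) = almost_all r (Suc i) P (c'(i := x))" for x
    by (rule Suc.IH) (use Suc.prems in auto)
  then show ?case by simp
qed

text \<open>\<open>S\<close> consists of the sequences whose entries all lie beyond thresholds that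
  make the remaining quantifiers true. Raising an entry keeps it beyond its threshold; later
  thresholds may change, but ALS leaves the later entries free to be chosen anew.\<close>

lemma almost_all_imp_ALS:
  assumes all: "almost_all K 0 P c"
    and cong: "\<And>A B. \<forall>j<K. A j = B j \<Longrightarrow> P A = P B"
  shows "\<exists>S. ALS S \<and> (\<forall>A\<in>S. P A)"
proof -
  define Z where "Z i = almost_all (K - i) i P" for i
  define good where "good j A = (\<forall>x\<ge>A j. Z (Suc j) (A(j := x)))" for j A
  have Z_cong: "Z i A = Z i B" if "i \<le> K" "\<forall>j<i. A j = B j" for i A B
    unfolding Z_def by (rule almost_all_cong) (use that cong in auto)
  have good_cong: "good j A = good j B" if "j < K" "\<forall>i\<le>j. A i = B i" for j A B
  proof -
    have "Z (Suc j) (A(j := x)) = Z (Suc j) (B(j := x))" for x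
      by (rule Z_cong) (use that in auto)
    then show ?thesis using that by (simp add: good_def)
  qed
  have extend: "\<exists>B. (\<forall>j<i. B j = A j) \<and> (\<forall>j. i \<le> j \<and> j < K \<longrightarrow> good j B)"
    if "i \<le> K" "Z i A" for i A
    using that
  proof (induction "K - i" arbitrary: i A)
    case 0
    then show ?case by auto
  next
    case (Suc r)
    have K: "K - i = Suc (K - Suc i)" using Suc.hyps(2) by simp
    obtain m where m: "\<And>x. x \<ge> m \<Longrightarrow> Z (Suc i) (A(i := x))"
      using Suc.prems(2) unfolding Z_def K by auto
    obtain B where B: "\<forall>j<Suc i. B j = (A(i := m)) j" "\<forall>j. Suc i \<le> j \<and> j < K \<longrightarrow> good j B"
      using Suc.hyps(1)[of "Suc i" "A(i := m)"] Suc.hyps(2) m[of m] by fastforce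
    have "good i (A(i := m))" using m by (simp add: good_def)
    then have "good i B" using good_cong[of i B "A(i := m)"] B(1) Suc.hyps(2) by auto
    then have "\<forall>j. i \<le> j \<and> j < K \<longrightarrow> good j B" using B(2) by (metis Suc_leI le_neq_implies_less)
    then show ?case using B(1) by (intro exI[of _ B]) auto
  qed
  define S where "S = {A. \<forall>j<K. good j A}"
  have "Z 0 c" using all by (simp add: Z_def)
  from extend[OF _ this] have "S \<noteq> {}" by (auto simp: S_def)
  moreover have "\<exists>B\<in>S. B i = A i + 1 \<and> (\<forall>j<i. B j = A j)" if "A \<in> S" for i A
  proof (cases "i < K")
    case False
    then have "good j (A(i := A i + 1)) = good j A" if "j < K" for j
      by (rule_tac good_cong) (use that in auto)
    then have "A(i := A i + 1) \<in> S" using that by (simp add: S_def)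
    then show ?thesis by (intro bexI[of _ "A(i := A i + 1)"]) auto
  next
    case True
    let ?A = "A(i := A i + 1)"
    have gA: "\<forall>x\<ge>A i. Z (Suc i) (A(i := x))" using that True by (simp add: S_def good_def)
    then obtain B where B: "\<forall>j<Suc i. B j = ?A j" "\<forall>j. Suc i \<le> j \<and> j < K \<longrightarrow> good j B"
      using extend[of "Suc i" ?A] True by auto
    have "good j B" if "j < K" for j
    proof -
      consider "j < i" | "j = i" | "j > i" by linarith
      then show ?thesis
      proof cases
        case 1
        then have "good j B = good j A" using good_cong[of j B A] B(1) True by auto
        then show ?thesis using \<open>A \<in> S\<close> that by (simp add: S_def)
      next
        case 2
        then have "good j B = good j ?A" using good_cong[of j B ?A] B(1) True by auto
        then show ?thesis using gA 2 by (simp add: good_def)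
      next
        case 3
        then show ?thesis using B(2) that by simp
      qed
    qed
    then show ?thesis using B(1) by (intro bexI[of _ B]) (auto simp: S_def)
  qed
  ultimately have "ALS S" by (simp add: ALS_def)
  moreover have "P A" if "A \<in> S" for A
  proof (cases K)
    case 0
    then show ?thesis using all cong[of c A] by simp
  next
    case (Suc k)
    then have "good k A" using that by (simp add: S_def)
    then have "Z (Suc k) (A(k := A k))" unfolding good_def by blast
    then show ?thesis using Suc by (simp add: Z_def)
  qed
  ultimately show ?thesis by auto
qed

text \<open>The bounds \<open>2 ^ c i\<close> may replace the unbounded quantifiers. Only environments vanishing from
  \<open>d\<close> on are considered, so that there are finitely many below given bounds.\<close>
definition adequate :: "cfm \<Rightarrow> nat \<Rightarrow> (nat \<Rightarrow> nat) \<Rightarrow> bool" where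
  "adequate p d c = (\<forall>e. (\<forall>i<d. e i < 2 ^ c i) \<longrightarrow> (\<forall>i\<ge>d. e i = 0) \<longrightarrow>
     csat (box c) d e p = csat (\<lambda>_. UNIV) d e p)"

text \<open>Only finitely many environments lie within the earlier bounds, so one number
  \<open>m\<close> exceeds or equals a chosen witness for each of them; later bounds serve the body
  of the quantifier.\<close>

lemma almost_all_adequate:
  assumes "depth p \<le> r"
  shows "almost_all r d (adequate p d) c"
  using assms
proof (induction p arbitrary: r d c)
  case (CAtom l r')
  show ?case by (rule almost_all_trivial) (simp add: adequate_def)
next
  case (CNeg p)
  then show ?case by (intro almost_all_mono[OF CNeg.IH]) (simp_all add: adequate_def)
next
  case (CAnd p q)
  then show ?case
    by (intro almost_all_mono[OF almost_all_conj[OF CAnd.IH(1) CAnd.IH(2)]]) (simp_all add: adequate_def)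
next
  case (CEx p r d c)
  then obtain s where r: "r = Suc s" and s: "depth p \<le> s" by (cases r) auto
  \<comment> \<open>The shape expected by \<open>finite_set_of_finite_funs\<close>, with one common
    bound for all variables; 0 is inserted because the image is empty for
    \<open>d = 0\<close>.\<close>
  let ?E = "{e. (\<forall>i. (i \<in> {..<d} \<longrightarrow> e i \<in> {..<Max (insert 0 ((\<lambda>i. 2 ^ c i :: nat) ` {..<d}))})
      \<and> (i \<notin> {..<d} \<longrightarrow> e i = 0))}"
  let ?Q = "\<lambda>e x. csat (\<lambda>_. UNIV) (Suc d) (e(d := x)) p"
  have "finite ?E" by (rule finite_set_of_finite_funs) auto
  then have fin: "finite ((\<lambda>e. SOME x. ?Q e x) ` ?E)" by simp
  define m where "m = Max (insert 0 ((\<lambda>e. SOME x. ?Q e x) ` ?E))"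
  have bounded: "\<exists>x\<le>m. ?Q e x"
    if "\<exists>x. ?Q e x" "\<forall>i<d. e i < 2 ^ c i" "\<forall>i\<ge>d. e i = 0" for e
  proof -
    have "e i < Max (insert 0 ((\<lambda>i. 2 ^ c i :: nat) ` {..<d}))" if "i < d" for i
    proof -
      have "2 ^ c i \<le> Max (insert 0 ((\<lambda>i. 2 ^ c i :: nat) ` {..<d}))" using that by (intro Max_ge) auto
      then show ?thesis using \<open>\<forall>i<d. e i < 2 ^ c i\<close> that less_le_trans by blast
    qed
    then have "e \<in> ?E" using that by auto
    then have "(SOME x. ?Q e x) \<le> m" unfolding m_def using fin by (intro Max_ge) auto
    moreover have "?Q e (SOME x. ?Q e x)" using that(1) by (rule someI_ex)
    ultimately show ?thesis by blast
  qed
  have "almost_all s (Suc d) (adequate (CEx p) d) (c(d := x))" if "x \<ge> m" for x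
  proof (rule almost_all_mono[OF CEx.IH[OF s]])
    fix c' assume c': "\<forall>j<Suc d. c' j = (c(d := x)) j" and ad: "adequate p (Suc d) c'"
    show "adequate (CEx p) d c'"
      unfolding adequate_def
    proof (intro allI impI)
      fix e :: "nat \<Rightarrow> nat" assume e: "\<forall>i<d. e i < 2 ^ c' i" "\<forall>i\<ge>d. e i = 0"
      have eq: "csat (box c') (Suc d) (e(d := y)) p = ?Q e y" if "y < 2 ^ c' d" for y
        using ad e that unfolding adequate_def by (auto simp: less_Suc_eq)
      have "\<forall>i<d. e i < 2 ^ c i" using e(1) c' by auto
      then have "(\<exists>y. ?Q e y) \<longleftrightarrow> (\<exists>y\<le>m. ?Q e y)" using bounded e(2) by blast
      moreover have "m < 2 ^ c' d" using c' le_less_trans[OF \<open>x \<ge> m\<close> less_exp] by simp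
      ultimately show "csat (box c') d e (CEx p) = csat (\<lambda>_. UNIV) d e (CEx p)"
        using eq by (auto intro: le_less_trans)
    qed
  qed
  then show ?case unfolding r by auto
qed

subsection \<open>Recognising arithmetical sets\<close>

text \<open>Every proper subterm is named by a fresh variable. The factors of a product thus become
  distinct variables even in \<open>x * x\<close>, which keeps monomials square-free.
  \<open>\<rho>\<close> translates de Bruijn indices into levels.\<close>

fun graph_cfm :: "nat \<Rightarrow> (nat \<Rightarrow> nat) \<Rightarrow> tm \<Rightarrow> nat \<Rightarrow> cfm" where
  "graph_cfm d \<rho> (Var i) k = CAtom [{\<rho> i}] [{k}]"
| "graph_cfm d \<rho> Zero k = CAtom [] [{k}]"
| "graph_cfm d \<rho> (Sc t) k = CEx (CAnd (graph_cfm (Suc d) \<rho> t d) (CAtom [{d}, {}] [{k}]))"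
| "graph_cfm d \<rho> (Pl t u) k = CEx (CEx (CAnd (graph_cfm (Suc (Suc d)) \<rho> t d)
     (CAnd (graph_cfm (Suc (Suc d)) \<rho> u (Suc d)) (CAtom [{d}, {Suc d}] [{k}]))))"
| "graph_cfm d \<rho> (Tm t u) k = CEx (CEx (CAnd (graph_cfm (Suc (Suc d)) \<rho> t d)
     (CAnd (graph_cfm (Suc (Suc d)) \<rho> u (Suc d)) (CAtom [{d, Suc d}] [{k}]))))"

lemma monomial_eq:
  assumes "J \<subseteq> {..<d}"
  shows "monomial J d e = prod e J"
proof -
  have "monomial J d e = (\<Prod>i\<in>{i \<in> {..<d}. i \<in> J}. e i)"
    unfolding monomial_def by (rule prod.inter_filter[symmetric]) simp
  also have "{i \<in> {..<d}. i \<in> J} = J" using assms by auto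
  finally show ?thesis .
qed

lemma csat_graph_cfm:
  assumes "\<And>i. \<rho> i < d" "k < d"
  shows "csat (\<lambda>_. UNIV) d e (graph_cfm d \<rho> t k) \<longleftrightarrow> e k = tval (\<lambda>i. e (\<rho> i)) t"
  using assms
proof (induction t arbitrary: d e k)
  case (Sc t)
  have "\<rho> i \<noteq> d" for i using Sc.prems(1)[of i] by simp
  then show ?case
    using Sc.IH[of "Suc d" d] Sc.prems less_SucI[OF Sc.prems(1)] by (auto simp: monomial_eq)
next
  case (Pl t u)
  have "\<rho> i \<noteq> d \<and> \<rho> i \<noteq> Suc d" for i using Pl.prems(1)[of i] by simp
  then show ?case
    using Pl.IH(1)[of "Suc (Suc d)" d] Pl.IH(2)[of "Suc (Suc d)" "Suc d"] Pl.prems(2)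
      less_SucI[OF less_SucI[OF Pl.prems(1)]]
    by (auto simp: monomial_eq)
next
  case (Tm t u)
  have "\<rho> i \<noteq> d \<and> \<rho> i \<noteq> Suc d" for i using Tm.prems(1)[of i] by simp
  then show ?case
    using Tm.IH(1)[of "Suc (Suc d)" d] Tm.IH(2)[of "Suc (Suc d)" "Suc d"] Tm.prems(2)
      less_SucI[OF less_SucI[OF Tm.prems(1)]]
    by (auto simp: monomial_eq)
qed (auto simp: monomial_eq)

definition less_cfm :: "nat \<Rightarrow> nat \<Rightarrow> nat \<Rightarrow> cfm" where
  "less_cfm d j k = CEx (CAtom [{j}, {d}, {}] [{k}])"

lemma csat_less_cfm:
  assumes "j < d" "k < d"
  shows "csat (\<lambda>_. UNIV) d e (less_cfm d j k) \<longleftrightarrow> e j < e k"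
proof -
  have "csat (\<lambda>_. UNIV) d e (less_cfm d j k) \<longleftrightarrow> (\<exists>x. e j + x + 1 = e k)"
    using assms by (simp add: less_cfm_def monomial_eq)
  then show ?thesis unfolding less_iff_Suc_add by (metis Suc_eq_plus1)
qed

definition relate_cfm :: "(nat \<Rightarrow> nat \<Rightarrow> nat \<Rightarrow> cfm) \<Rightarrow> nat \<Rightarrow> (nat \<Rightarrow> nat) \<Rightarrow> tm \<Rightarrow> tm \<Rightarrow> cfm" where
  "relate_cfm R d \<rho> t u = CEx (CEx (CAnd (graph_cfm (Suc (Suc d)) \<rho> t d)
     (CAnd (graph_cfm (Suc (Suc d)) \<rho> u (Suc d)) (R (Suc (Suc d)) d (Suc d)))))"

lemma csat_relate_cfm:
  assumes "\<And>i. \<rho> i < d"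
    and "\<And>e. csat (\<lambda>_. UNIV) (Suc (Suc d)) e (R (Suc (Suc d)) d (Suc d)) \<longleftrightarrow> rel (e d) (e (Suc d))"
  shows "csat (\<lambda>_. UNIV) d e (relate_cfm R d \<rho> t u) \<longleftrightarrow> rel (tval (\<lambda>i. e (\<rho> i)) t) (tval (\<lambda>i. e (\<rho> i)) u)"
proof -
  have "\<rho> i \<noteq> d \<and> \<rho> i \<noteq> Suc d" for i using assms(1)[of i] by simp
  then show ?thesis
    using csat_graph_cfm[of \<rho> "Suc (Suc d)" d] csat_graph_cfm[of \<rho> "Suc (Suc d)" "Suc d"]
      less_SucI[OF less_SucI[OF assms(1)]] assms(2)
    by (auto simp: relate_cfm_def)
qed

fun cfm_of :: "nat \<Rightarrow> (nat \<Rightarrow> nat) \<Rightarrow> fm \<Rightarrow> cfm" where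
  "cfm_of d \<rho> (Eq t u) = relate_cfm (\<lambda>_ j k. CAtom [{j}] [{k}]) d \<rho> t u"
| "cfm_of d \<rho> (Lt t u) = relate_cfm less_cfm d \<rho> t u"
| "cfm_of d \<rho> (Neg p) = CNeg (cfm_of d \<rho> p)"
| "cfm_of d \<rho> (Conj p q) = CAnd (cfm_of d \<rho> p) (cfm_of d \<rho> q)"
| "cfm_of d \<rho> (Disj p q) = CNeg (CAnd (CNeg (cfm_of d \<rho> p)) (CNeg (cfm_of d \<rho> q)))"
| "cfm_of d \<rho> (BEx t p) = CEx (CAnd
     (CEx (CAnd (graph_cfm (Suc (Suc d)) \<rho> t (Suc d)) (less_cfm (Suc (Suc d)) d (Suc d))))
     (cfm_of (Suc d) (cons_env d \<rho>) p))"
| "cfm_of d \<rho> (BAll t p) = CNeg (CEx (CAnd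
     (CEx (CAnd (graph_cfm (Suc (Suc d)) \<rho> t (Suc d)) (less_cfm (Suc (Suc d)) d (Suc d))))
     (CNeg (cfm_of (Suc d) (cons_env d \<rho>) p))))"
| "cfm_of d \<rho> (Ex p) = CEx (cfm_of (Suc d) (cons_env d \<rho>) p)"
| "cfm_of d \<rho> (All p) = CNeg (CEx (CNeg (cfm_of (Suc d) (cons_env d \<rho>) p)))"

lemma csat_cfm_of:
  assumes "\<And>i. \<rho> i < d"
  shows "csat (\<lambda>_. UNIV) d e (cfm_of d \<rho> p) \<longleftrightarrow> sat (\<lambda>i. e (\<rho> i)) p"
  using assms
proof (induction p arbitrary: d \<rho> e)
  have bound: "csat (\<lambda>_. UNIV) (Suc d) (e(d := x))
      (CEx (CAnd (graph_cfm (Suc (Suc d)) \<rho> t (Suc d)) (less_cfm (Suc (Suc d)) d (Suc d))))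
      \<longleftrightarrow> x < tval (\<lambda>i. e (\<rho> i)) t" if "\<And>i. \<rho> i < d" for d \<rho> e x t
  proof -
    have "\<rho> i \<noteq> d \<and> \<rho> i \<noteq> Suc d" for i using that[of i] by simp
    then show ?thesis
      using csat_graph_cfm[of \<rho> "Suc (Suc d)" "Suc d"] less_SucI[OF less_SucI[OF that]]
      by (auto simp: csat_less_cfm)
  qed
  have body: "csat (\<lambda>_. UNIV) (Suc d) (e(d := x)) (cfm_of (Suc d) (cons_env d \<rho>) p)
      \<longleftrightarrow> sat (cons_env x (\<lambda>i. e (\<rho> i))) p"
    if "\<And>d \<rho> e. (\<And>i. \<rho> i < d) \<Longrightarrow> csat (\<lambda>_. UNIV) d e (cfm_of d \<rho> p) = sat (\<lambda>i. e (\<rho> i)) p"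
      "\<And>i. \<rho> i < d" for d \<rho> e x p
  proof -
    have "\<rho> i \<noteq> d" for i using that(2)[of i] by simp
    then have "(\<lambda>i. (e(d := x)) (cons_env d \<rho> i)) = cons_env x (\<lambda>i. e (\<rho> i))"
      by (auto simp: cons_env_def)
    then show ?thesis
      using that(1)[of "cons_env d \<rho>" "Suc d" "e(d := x)"] less_SucI[OF that(2)]
      by (simp add: cons_env_def)
  qed
  {
    case (Eq t u)
    then show ?case
      by (simp add: csat_relate_cfm[where rel = "(=)"] monomial_eq)
  next
    case (Lt t u)
    then show ?case
      by (simp add: csat_relate_cfm[where rel = "(<)"] csat_less_cfm)
  next
    case (BEx t p)
    show ?case 
      using bound[OF BEx.prems] body[OF BEx.IH BEx.prems] by auto
  next
    case (BAll t p)
    then show ?case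
      using bound[OF BAll.prems] body[OF BAll.IH BAll.prems] by auto
  next
    case (Ex p)
    then show ?case using body[OF Ex.IH Ex.prems] by simp
  next
    case (All p)
    then show ?case using body[OF All.IH All.prems] by simp
  }
qed simp_all

lemma defined_set_ASRAM: "defined_set p \<in> ASRAM_O1"
proof -
  \<comment> \<open>A formula may have free variables other than 0, which \<open>defined_set\<close>
    sets to 0. They all become level 1, which \<open>q\<close> binds and forces to be 0.\<close>
  define \<rho> where "\<rho> i = (if i = 0 then 0 else 1 :: nat)" for i :: nat
  define q where "q = CEx (CAnd (CAtom [] [{1}]) (cfm_of 2 \<rho> p))"
  have q: "csat (\<lambda>_. UNIV) 1 ((\<lambda>_. 0)(0 := n)) q \<longleftrightarrow> n \<in> defined_set p" for n
  proof -
    have "(\<lambda>i. ((\<lambda>_. 0)(0 := n, 1 := 0)) (\<rho> i)) = (\<lambda>_. 0)(0 := n)" by (auto simp: \<rho>_def)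
    then have "csat (\<lambda>_. UNIV) 2 ((\<lambda>_. 0)(0 := n, 1 := 0)) (cfm_of 2 \<rho> p) \<longleftrightarrow> n \<in> defined_set p"
      using csat_cfm_of[of \<rho> 2] by (simp add: \<rho>_def defined_set_def)
    then show ?thesis
      by (auto simp: q_def monomial_eq numeral_2_eq_2)
  qed
  obtain F where F: "computable F"
    and Fq: "\<And>v. v 0 < 2 ^ v 1 \<Longrightarrow> F v = of_bool (csat (box (\<lambda>i. v (Suc i))) 1 ((\<lambda>_. 0)(0 := v 0)) q)"
    using computable_truth[OF order_refl, of q] by auto
  obtain x where x: "\<And>v. regular x v \<and> eval x v = F v" using F unfolding computable_def by blast
  obtain n where n: "vars_below n x" using ex_vars_below by blast
  define f where "f inp = (of_bool (inp \<in> defined_set p) :: nat)" for inp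
  have "\<exists>S. ALS S \<and> (\<forall>A\<in>S. halts_with (program x n) A inp (f inp))" for inp
  proof -
    let ?P = "\<lambda>A. inp < 2 ^ A 0 \<and> adequate q 1 A"
    let ?zero = "(\<lambda>_. 0) :: nat \<Rightarrow> nat"
    \<comment> \<open>Entry 0 bounds the input, the next \<open>depth q\<close> entries bound the
      quantifiers, and \<open>n\<close> more ensure that every entry read by the expression is
      covered.\<close>
    have "almost_all (depth q + n) 1 ?P (?zero(0 := y))" if "y \<ge> inp" for y
    proof (rule almost_all_mono[OF almost_all_adequate[OF le_add1]])
      fix c' assume "\<forall>j<1. c' j = (?zero(0 := y)) j" "adequate q 1 c'"
      moreover have "inp < 2 ^ y" using that less_exp[of y] by linarith
      ultimately show "?P c'" by simp
    qed
    then have "almost_all (Suc (depth q + n)) 0 ?P ?zero" by auto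
    then have "almost_all (Suc (depth q + n)) 0 (\<lambda>A. eval x (inputs inp A) = f inp) ?zero"
    proof (rule almost_all_mono)
      fix A assume "?P A"
      then show "eval x (inputs inp A) = f inp"
        using Fq[of "inputs inp A"] q[of inp] x[of "inputs inp A"]
        by (auto simp: inputs_def adequate_def f_def)
    qed
    then have "\<exists>S. ALS S \<and> (\<forall>A\<in>S. eval x (inputs inp A) = f inp)"
    proof (rule almost_all_imp_ALS)
      fix A B :: "nat \<Rightarrow> nat" assume "\<forall>j<Suc (depth q + n). A j = B j"
      then have "eval x (inputs inp A) = eval x (inputs inp B)"
        using eval_regular_cong[OF n, of "inputs inp A" "inputs inp B"] by (simp add: inputs_def)
      then show "(eval x (inputs inp A) = f inp) = (eval x (inputs inp B) = f inp)" by simp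
    qed
    moreover have "vars_below (Suc n) x" using n by (rule vars_below_mono) simp
    ultimately show ?thesis using halts_with_program x by metis
  qed
  then have "asram_recognises (program x n) (defined_set p)"
    unfolding asram_recognises_def asram_computes_def
    by (intro exI[of _ f]) (simp add: f_def)
  then show ?thesis unfolding ASRAM_O1_def using program_const_time by blast
qed

subsection \<open>Arithmetical predicates and functions\<close>

text \<open>Alternations are not counted: membership in the union of all levels only asks for some
  level.\<close>

inductive prenex :: "fm \<Rightarrow> bool" where
  prenex_delta0: "delta0 p \<Longrightarrow> prenex p"
| prenex_Ex: "prenex p \<Longrightarrow> prenex (Ex p)"
| prenex_All: "prenex p \<Longrightarrow> prenex (All p)"

lemma prenex_sigma_fm: "prenex p \<Longrightarrow> \<exists>n. sigma_fm n p"
proof (induction rule: prenex.induct)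
  case (prenex_delta0 p)
  then show ?case using sigma_fm_pi_fm.intros(1) by blast
next
  case (prenex_Ex p)
  then show ?case by (metis sigma_fm_pi_fm.intros(3-5))
next
  case (prenex_All p)
  then show ?case by (metis sigma_fm_pi_fm.intros(3,5,6))
qed

fun ren_tm :: "(nat \<Rightarrow> nat) \<Rightarrow> tm \<Rightarrow> tm" where
  "ren_tm g (Var i) = Var (g i)"
| "ren_tm g Zero = Zero"
| "ren_tm g (Sc t) = Sc (ren_tm g t)"
| "ren_tm g (Pl t u) = Pl (ren_tm g t) (ren_tm g u)"
| "ren_tm g (Tm t u) = Tm (ren_tm g t) (ren_tm g u)"

abbreviation lift_ren :: "(nat \<Rightarrow> nat) \<Rightarrow> nat \<Rightarrow> nat" where
  "lift_ren g \<equiv> cons_env 0 (\<lambda>i. Suc (g i))"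

fun ren :: "(nat \<Rightarrow> nat) \<Rightarrow> fm \<Rightarrow> fm" where
  "ren g (Eq t u) = Eq (ren_tm g t) (ren_tm g u)"
| "ren g (Lt t u) = Lt (ren_tm g t) (ren_tm g u)"
| "ren g (Neg p) = Neg (ren g p)"
| "ren g (Conj p q) = Conj (ren g p) (ren g q)"
| "ren g (Disj p q) = Disj (ren g p) (ren g q)"
| "ren g (BEx t p) = BEx (ren_tm g t) (ren (lift_ren g) p)"
| "ren g (BAll t p) = BAll (ren_tm g t) (ren (lift_ren g) p)"
| "ren g (Ex p) = Ex (ren (lift_ren g) p)"
| "ren g (All p) = All (ren (lift_ren g) p)"

lemma tval_ren_tm: "tval e (ren_tm g t) = tval (\<lambda>i. e (g i)) t"
  by (induction t) auto

lemma sat_ren: "sat e (ren g p) = sat (\<lambda>i. e (g i)) p"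
proof (induction p arbitrary: e g)
  have "(\<lambda>i. cons_env x e (lift_ren g i)) = cons_env x (\<lambda>i. e (g i))" for x e g
    by (auto simp: cons_env_def)
  note this [simp]
  {
    case (BEx t p)
    then show ?case by (simp add: tval_ren_tm)
  next
    case (BAll t p)
    then show ?case by (simp add: tval_ren_tm)
  next
    case (Ex p)
    then show ?case by simp
  next
    case (All p)
    then show ?case by simp
  }
qed (simp_all add: tval_ren_tm)

lemma delta0_ren: "delta0 p \<Longrightarrow> delta0 (ren g p)"
  by (induction p arbitrary: g) auto

lemma prenex_ren: "prenex p \<Longrightarrow> prenex (ren g p)"
  by (induction arbitrary: g rule: prenex.induct) (auto intro: prenex.intros delta0_ren)

lemma cons_env_simps [simp]: "cons_env x e 0 = x" "cons_env x e (Suc i) = e i"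
  by (simp_all add: cons_env_def)

section \<open>Closure properties of definable predicates\<close>

definition definable :: "((nat \<Rightarrow> nat) \<Rightarrow> bool) \<Rightarrow> bool" where
  "definable \<phi> = (\<exists>p. prenex p \<and> (\<forall>e. sat e p = \<phi> e))"

lemma definable_ren:
  assumes "definable \<phi>"
  shows "definable (\<lambda>e. \<phi> (\<lambda>i. e (g i)))"
proof -
  obtain p where "prenex p" "\<And>e. sat e p = \<phi> e" using assms unfolding definable_def by blast
  then show ?thesis
    unfolding definable_def by (intro exI[of _ "ren g p"]) (simp add: prenex_ren sat_ren)
qed

lemma definable_not:
  assumes "definable \<phi>"
  shows "definable (\<lambda>e. \<not> \<phi> e)"
proof -
  have "\<exists>q. prenex q \<and> (\<forall>e. sat e q = (\<not> sat e p))" if "prenex p" for p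
    using that
  proof (induction rule: prenex.induct)
    case (prenex_delta0 p)
    then show ?case by (intro exI[of _ "Neg p"]) (auto intro: prenex.intros)
  next
    case (prenex_Ex p)
    then obtain q where "prenex q" "\<forall>e. sat e q = (\<not> sat e p)" by blast
    then show ?case by (intro exI[of _ "All q"]) (auto intro: prenex.intros)
  next
    case (prenex_All p)
    then obtain q where "prenex q" "\<forall>e. sat e q = (\<not> sat e p)" by blast
    then show ?case by (intro exI[of _ "Ex q"]) (auto intro: prenex.intros)
  qed
  then show ?thesis using assms unfolding definable_def by metis
qed

text \<open>The premise follows the de Bruijn convention of \<open>sat\<close>. Used as an
  introduction rule, it lets formulas be built by unification from ordinary predicates.\<close>

lemma definable_ex:
  assumes "definable (\<lambda>e. \<phi> (e 0) (\<lambda>i. e (Suc i)))"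
  shows "definable (\<lambda>e. \<exists>x. \<phi> x e)"
proof -
  obtain p where p: "prenex p" "\<And>e. sat e p = \<phi> (e 0) (\<lambda>i. e (Suc i))"
    using assms unfolding definable_def by blast
  then show ?thesis
    unfolding definable_def by (intro exI[of _ "Ex p"]) (auto intro: prenex.intros)
qed

lemma definable_conj:
  assumes "definable \<phi>" "definable \<psi>"
  shows "definable (\<lambda>e. \<phi> e \<and> \<psi> e)"
proof -
  have shift: "sat (cons_env x e) (ren Suc q) = sat e q" for x e q
    by (simp add: sat_ren)
  have delta0: "\<exists>r. prenex r \<and> (\<forall>e. sat e r = (sat e p \<and> sat e q))" if "prenex q" "delta0 p" for p q
    using that
  proof (induction arbitrary: p rule: prenex.induct)
    case (prenex_delta0 q)
    then show ?case by (intro exI[of _ "Conj p q"]) (auto intro: prenex.intros)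
  next
    case (prenex_Ex q)
    then obtain r where "prenex r" "\<forall>e. sat e r = (sat e (ren Suc p) \<and> sat e q)"
      using delta0_ren by blast
    then show ?case by (intro exI[of _ "Ex r"]) (auto intro: prenex.intros simp: shift)
  next
    case (prenex_All q)
    then obtain r where "prenex r" "\<forall>e. sat e r = (sat e (ren Suc p) \<and> sat e q)"
      using delta0_ren by blast
    then show ?case by (intro exI[of _ "All r"]) (auto intro: prenex.intros simp: shift)
  qed
  have "\<exists>r. prenex r \<and> (\<forall>e. sat e r = (sat e p \<and> sat e q))" if "prenex p" "prenex q" for p q
    using that
  proof (induction arbitrary: q rule: prenex.induct)
    case (prenex_delta0 p)
    then show ?case using delta0 by blast
  next
    case (prenex_Ex p)
    then obtain r where "prenex r" "\<forall>e. sat e r = (sat e p \<and> sat e (ren Suc q))"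
      using prenex_ren by blast
    then show ?case by (intro exI[of _ "Ex r"]) (auto intro: prenex.intros simp: shift)
  next
    case (prenex_All p)
    then obtain r where "prenex r" "\<forall>e. sat e r = (sat e p \<and> sat e (ren Suc q))"
      using prenex_ren by blast
    then show ?case by (intro exI[of _ "All r"]) (auto intro: prenex.intros simp: shift)
  qed
  then show ?thesis using assms unfolding definable_def by metis
qed

lemma definable_disj:
  assumes "definable \<phi>" "definable \<psi>"
  shows "definable (\<lambda>e. \<phi> e \<or> \<psi> e)"
  using definable_not[OF definable_conj[OF definable_not[OF assms(1)] definable_not[OF assms(2)]]]
  by simp

lemma definable_imp:
  assumes "definable \<phi>" "definable \<psi>"
  shows "definable (\<lambda>e. \<phi> e \<longrightarrow> \<psi> e)"
  using definable_disj[OF definable_not[OF assms(1)] assms(2)] by simp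

lemma definable_all:
  assumes "definable (\<lambda>e. \<phi> (e 0) (\<lambda>i. e (Suc i)))"
  shows "definable (\<lambda>e. \<forall>x. \<phi> x e)"
proof -
  have "definable (\<lambda>e. \<not> (\<exists>x. \<not> \<phi> x e))"
    by (intro definable_not definable_ex assms)
  then show ?thesis by simp
qed

lemma definable_const: "definable (\<lambda>e. b)"
proof (cases b)
  case True
  then show ?thesis
    unfolding definable_def by (intro exI[of _ "Eq Zero Zero"]) (auto intro: prenex.intros)
next
  case False
  then show ?thesis
    unfolding definable_def by (intro exI[of _ "Lt Zero Zero"]) (auto intro: prenex.intros)
qed

section \<open>Functions with definable graph\<close>

definition dfun :: "((nat \<Rightarrow> nat) \<Rightarrow> nat) \<Rightarrow> bool" where
  "dfun F = definable (\<lambda>e. e 0 = F (\<lambda>i. e (Suc i)))"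

lemma definable_subst:
  assumes "definable (\<lambda>e. \<phi> (e 0) (\<lambda>i. e (Suc i)))" "dfun F"
  shows "definable (\<lambda>e. \<phi> (F e) e)"
proof -
  have "definable (\<lambda>e. \<exists>x. x = F e \<and> \<phi> x e)"
    by (intro definable_ex definable_conj assms(1) assms(2)[unfolded dfun_def])
  then show ?thesis by simp
qed

lemma dfun_shift: "dfun F \<Longrightarrow> dfun (\<lambda>e. F (\<lambda>i. e (Suc i)))"
  unfolding dfun_def
  by (drule definable_ren[where g = "\<lambda>i. if i = 0 then 0 else Suc i"]) simp

lemma definable_apply2:
  assumes "definable (\<lambda>e. R (e 0) (e (Suc 0)))" "dfun F" "dfun G"
  shows "definable (\<lambda>e. R (F e) (G e))"
proof -
  \<comment> \<open>The renaming \<open>1 - i\<close> swaps variables 0 and 1; truncation on larger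
    indices is harmless because \<open>R\<close> reads only these two.\<close>
  have "definable (\<lambda>e. R (e (Suc 0)) (e 0))"
    using definable_ren[OF assms(1), of "\<lambda>i. 1 - i"] by simp
  then have "definable (\<lambda>e. R (e 0) (G (\<lambda>i. e (Suc i))))"
    using dfun_shift[OF assms(3)] by (rule definable_subst[where \<phi> = "\<lambda>y e. R (e 0) y"])
  then show ?thesis using assms(2) by (rule definable_subst[where \<phi> = "\<lambda>x e. R x (G e)"])
qed

lemma definable_apply3:
  assumes "definable (\<lambda>e. R (e 0) (e (Suc 0)) (e (Suc (Suc 0))))" "dfun F" "dfun G" "dfun H"
  shows "definable (\<lambda>e. R (F e) (G e) (H e))"
proof -
  have "definable (\<lambda>e. R (e (Suc (Suc 0))) (e (Suc 0)) (e 0))"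
    using definable_ren[OF assms(1), of "\<lambda>i. 2 - i"] by (simp add: numeral_2_eq_2)
  then have "definable (\<lambda>e. R (e (Suc 0)) (e 0) (H (\<lambda>i. e (Suc (Suc i)))))"
    using dfun_shift[OF dfun_shift[OF assms(4)]]
    by (rule definable_subst[where \<phi> = "\<lambda>z e. R (e (Suc 0)) (e 0) z"])
  then have "definable (\<lambda>e. R (e 0) (G (\<lambda>i. e (Suc i))) (H (\<lambda>i. e (Suc i))))"
    using dfun_shift[OF assms(3)]
    by (rule definable_subst[where \<phi> = "\<lambda>y e. R (e 0) y (H (\<lambda>i. e (Suc i)))"])
  then show ?thesis using assms(2) by (rule definable_subst[where \<phi> = "\<lambda>x e. R x (G e) (H e)"])
qed

lemma dfun_var: "dfun (\<lambda>e. e i)"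
  unfolding dfun_def definable_def
  by (intro exI[of _ "Eq (Var 0) (Var (Suc i))"]) (auto intro: prenex.intros)

lemma dfun_apply1:
  assumes "definable (\<lambda>e. e 0 = h (e (Suc 0)))" "dfun F"
  shows "dfun (\<lambda>e. h (F e))"
  unfolding dfun_def
  using definable_apply2[OF assms(1) dfun_var[of 0] dfun_shift[OF assms(2)]] .

lemma dfun_apply2:
  assumes "definable (\<lambda>e. e 0 = h (e (Suc 0)) (e (Suc (Suc 0))))" "dfun F" "dfun G"
  shows "dfun (\<lambda>e. h (F e) (G e))"
  unfolding dfun_def
  using definable_apply3[OF assms(1) dfun_var[of 0] dfun_shift[OF assms(2)] dfun_shift[OF assms(3)]] .

lemma dfun_const: "dfun (\<lambda>e. c)"
proof -
  have "tval e ((Sc ^^ c) Zero) = c" for e by (induction c) auto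
  then show ?thesis
    unfolding dfun_def definable_def
    by (intro exI[of _ "Eq (Var 0) ((Sc ^^ c) Zero)"]) (auto intro: prenex.intros)
qed

lemma dfun_add:
  assumes "dfun F" "dfun G"
  shows "dfun (\<lambda>e. F e + G e)"
  using _ assms
proof (rule dfun_apply2[where h = "(+)"])
  show "definable (\<lambda>e. e 0 = e (Suc 0) + e (Suc (Suc 0)))"
    unfolding definable_def
    by (intro exI[of _ "Eq (Var 0) (Pl (Var (Suc 0)) (Var (Suc (Suc 0))))"]) (simp add: prenex_delta0)
qed

lemma dfun_mult:
  assumes "dfun F" "dfun G"
  shows "dfun (\<lambda>e. F e * G e)"
  using _ assms
proof (rule dfun_apply2[where h = "(*)"])
  show "definable (\<lambda>e. e 0 = e (Suc 0) * e (Suc (Suc 0)))"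
    unfolding definable_def
    by (intro exI[of _ "Eq (Var 0) (Tm (Var (Suc 0)) (Var (Suc (Suc 0))))"]) (simp add: prenex_delta0)
qed

lemma dfun_Suc:
  assumes "dfun F"
  shows "dfun (\<lambda>e. Suc (F e))"
  using dfun_add[OF assms dfun_const[of 1]] by simp

lemma definable_eq:
  assumes "dfun F" "dfun G"
  shows "definable (\<lambda>e. F e = G e)"
  using _ assms
proof (rule definable_apply2[where R = "(=)"])
  show "definable (\<lambda>e. e 0 = e (Suc 0))"
    unfolding definable_def by (intro exI[of _ "Eq (Var 0) (Var (Suc 0))"]) (simp add: prenex_delta0)
qed

lemma definable_less:
  assumes "dfun F" "dfun G"
  shows "definable (\<lambda>e. F e < G e)"
  using _ assms
proof (rule definable_apply2[where R = "(<)"])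
  show "definable (\<lambda>e. e 0 < e (Suc 0))"
    unfolding definable_def by (intro exI[of _ "Lt (Var 0) (Var (Suc 0))"]) (simp add: prenex_delta0)
qed

lemma dfun_if:
  assumes "definable c" "dfun F" "dfun G"
  shows "dfun (\<lambda>e. if c e then F e else G e)"
proof -
  have c: "definable (\<lambda>e. c (\<lambda>i. e (Suc i)))" using assms(1) by (rule definable_ren)
  have "definable (\<lambda>e. (c (\<lambda>i. e (Suc i)) \<longrightarrow> e 0 = F (\<lambda>i. e (Suc i)))
      \<and> (\<not> c (\<lambda>i. e (Suc i)) \<longrightarrow> e 0 = G (\<lambda>i. e (Suc i))))"
    by (intro definable_conj definable_imp definable_not c assms[unfolded dfun_def])
  moreover have "(\<lambda>e. (c (\<lambda>i. e (Suc i)) \<longrightarrow> e 0 = F (\<lambda>i. e (Suc i)))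
      \<and> (\<not> c (\<lambda>i. e (Suc i)) \<longrightarrow> e 0 = G (\<lambda>i. e (Suc i))))
      = (\<lambda>e. e 0 = (if c (\<lambda>i. e (Suc i)) then F (\<lambda>i. e (Suc i)) else G (\<lambda>i. e (Suc i))))"
    by auto
  ultimately show ?thesis unfolding dfun_def by simp
qed

lemmas definable_intros = definable_ex definable_all definable_conj definable_disj definable_imp
  definable_not definable_eq definable_less dfun_const dfun_var dfun_add dfun_mult dfun_Suc

lemma dfun_mod:
  assumes "dfun F" "dfun G"
  shows "dfun (\<lambda>e. F e mod G e)"
  using _ assms
proof (rule dfun_apply2[where h = "(mod)"])
  have "y = a mod b \<longleftrightarrow> (b = 0 \<and> y = a) \<or> (y < b \<and> (\<exists>q. a = b * q + y))" for y a b :: nat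
    by (cases "b = 0") (auto, metis mult_div_mod_eq)
  then show "definable (\<lambda>e. e 0 = e (Suc 0) mod e (Suc (Suc 0)))"
    by (simp only:) (intro definable_intros)
qed

lemma dfun_div:
  assumes "dfun F" "dfun G"
  shows "dfun (\<lambda>e. F e div G e)"
  using _ assms
proof (rule dfun_apply2[where h = "(div)"])
  have "y = a div b \<longleftrightarrow> (b = 0 \<and> y = 0) \<or> (\<exists>r. r < b \<and> a = b * y + r)" for y a b :: nat
    by (cases "b = 0") (auto, metis mult_div_mod_eq mod_less_divisor)
  then show "definable (\<lambda>e. e 0 = e (Suc 0) div e (Suc (Suc 0)))"
    by (simp only:) (intro definable_intros)
qed

text \<open>With \<open>t = fact N\<close> the moduli are pairwise coprime: a common prime cannot
  divide \<open>t\<close>, so it divides some \<open>j - i \<le> N\<close> and hence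
  \<open>t\<close> after all. Since also \<open>f i \<le> N \<le> t\<close>, the residues are the
  values themselves.\<close>

lemma beta_function:
  fixes f :: "nat \<Rightarrow> nat"
  shows "\<exists>s t. \<forall>i\<le>n. s mod Suc (t * Suc i) = f i"
proof -
  define N where "N = Max (insert (Suc n) (f ` {..n}))"
  define t where "t = (fact N :: nat)"
  let ?m = "\<lambda>i. Suc (t * Suc i)"
  have N: "Suc n \<le> N" "\<And>i. i \<le> n \<Longrightarrow> f i \<le> N"
    unfolding N_def by (intro Max_ge; simp)+
  have coprime_less: "coprime (?m i) (?m j)" if "i < j" "j \<le> n" for i j
  proof (rule ccontr)
    assume "\<not> coprime (?m i) (?m j)"
    then have "gcd (?m i) (?m j) \<noteq> 1" by (simp only: coprime_iff_gcd_eq_1 not_False_eq_True)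
    from prime_factor_nat[OF this] obtain p where p: "prime p" "p dvd ?m i" "p dvd ?m j"
      by (auto simp only: gcd_greatest_iff)
    have nt: "\<not> p dvd t"
    proof
      assume "p dvd t"
      then have "p dvd t * Suc i" by simp
      then have "p dvd 1" using p(2) dvd_add_right_iff[of p "t * Suc i" 1] by (simp only: Suc_eq_plus1)
      then show False using p(1) by simp
    qed
    have "p dvd ?m j - ?m i" using p(3,2) by (rule dvd_diff_nat)
    also have "?m j - ?m i = t * (j - i)" by (simp add: diff_mult_distrib2)
    finally have "p dvd j - i" using nt p(1) prime_dvd_mult_iff by blast
    then have "p \<le> j - i" using that by (intro dvd_imp_le) auto
    then have "p \<le> N" using that N(1) by linarith
    then have "p dvd t" unfolding t_def using p(1) by (intro dvd_fact) (auto dest: prime_gt_0_nat)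
    with nt show False by contradiction
  qed
  have cop: "coprime (?m i) (?m j)" if "i \<noteq> j" "i \<le> n" "j \<le> n" for i j
    using that coprime_less[of i j] coprime_less[of j i] by (cases "i < j") (auto simp: coprime_commute)
  have "\<exists>s. \<forall>i\<in>{..n}. [s = f i] (mod ?m i)"
    by (rule chinese_remainder_nat) (use cop in auto)
  then obtain s where s: "\<And>i. i \<le> n \<Longrightarrow> [s = f i] (mod ?m i)" by auto
  have "s mod ?m i = f i" if "i \<le> n" for i
  proof -
    have "f i \<le> N" using N(2) that .
    also have "N \<le> t" unfolding t_def by (rule fact_ge_self)
    also have "t < ?m i" by simp
    finally show ?thesis using s[OF that] by (simp add: cong_def)
  qed
  then show ?thesis by blast
qed

lemma dfun_power2:
  assumes "dfun F"
  shows "dfun (\<lambda>e. 2 ^ F e)"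
  using _ assms
proof (rule dfun_apply1[where h = "\<lambda>b. 2 ^ b"])
  \<comment> \<open>The pair \<open>s\<close>, \<open>t\<close> codes the sequence of powers up to
    \<open>2 ^ b\<close>, which is pinned down by its first element and the doubling rule.\<close>
  have "c = 2 ^ b \<longleftrightarrow> (\<exists>s t. s mod Suc (t * Suc 0) = 1
      \<and> (\<forall>i. i < b \<longrightarrow> s mod Suc (t * Suc (Suc i)) = 2 * (s mod Suc (t * Suc i)))
      \<and> s mod Suc (t * Suc b) = c)" for b c :: nat
  proof
    assume "c = 2 ^ b"
    moreover obtain s t where "\<forall>i\<le>b. s mod Suc (t * Suc i) = 2 ^ i"
      using beta_function[of b "\<lambda>i. 2 ^ i"] by blast
    ultimately show "\<exists>s t. s mod Suc (t * Suc 0) = 1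
      \<and> (\<forall>i. i < b \<longrightarrow> s mod Suc (t * Suc (Suc i)) = 2 * (s mod Suc (t * Suc i)))
      \<and> s mod Suc (t * Suc b) = c"
      by (intro exI[of _ s] exI[of _ t]) (auto simp del: mult_Suc_right simp: Suc_le_eq)
  next
    assume "\<exists>s t. s mod Suc (t * Suc 0) = 1
      \<and> (\<forall>i. i < b \<longrightarrow> s mod Suc (t * Suc (Suc i)) = 2 * (s mod Suc (t * Suc i)))
      \<and> s mod Suc (t * Suc b) = c"
    then obtain s t where 0: "s mod Suc (t * Suc 0) = 1"
      and step: "\<And>i. i < b \<Longrightarrow> s mod Suc (t * Suc (Suc i)) = 2 * (s mod Suc (t * Suc i))"
      and c: "s mod Suc (t * Suc b) = c" by blast
    have "i \<le> b \<Longrightarrow> s mod Suc (t * Suc i) = 2 ^ i" for i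
    proof (induction i)
      case 0
      then show ?case using \<open>s mod Suc (t * Suc 0) = 1\<close> by simp
    next
      case (Suc i)
      then show ?case using step[of i] by (simp del: mult_Suc_right)
    qed
    then show "c = 2 ^ b" using c by blast
  qed
  then show "definable (\<lambda>e. e 0 = 2 ^ e (Suc 0))"
    by (simp only:) (intro definable_intros dfun_mod)
qed

lemma dfun_bitop:
  assumes "\<not> f False False" "dfun F" "dfun G"
  shows "dfun (\<lambda>e. bitop f (F e) (G e))"
  using _ assms(2,3)
proof (rule dfun_apply2[where h = "bitop f"])
  \<comment> \<open>As \<open>f False False\<close> is false, \<open>f\<close> is a disjunction over
    the three other rows of its truth table, each guarded by a constant.\<close>
  define b11 b10 b01 where b: "b11 = f True True" "b10 = f True False" "b01 = f False True"
  have iff: "f p q \<longleftrightarrow> (p \<and> q \<and> b11) \<or> (p \<and> \<not> q \<and> b10) \<or> (\<not> p \<and> q \<and> b01)" for p q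
    using assms(1) by (cases p; cases q) (auto simp: b)
  have odd: "odd n \<longleftrightarrow> n mod 2 = 1" for n :: nat by presburger
  \<comment> \<open>Two implications replace the equivalence because the introduction rules have
    none for it.\<close>
  have "y = bitop f a b \<longleftrightarrow> (\<forall>i. (bit y i \<longrightarrow> f (bit a i) (bit b i)) \<and> (f (bit a i) (bit b i) \<longrightarrow> bit y i))" for y a b
    using bit_bitop[where f = f, OF assms(1)] by (auto simp: bit_eq_iff)
  then show "definable (\<lambda>e. e 0 = bitop f (e (Suc 0)) (e (Suc (Suc 0))))"
    by (simp only: iff bit_iff_odd odd)
      (intro definable_intros definable_const dfun_mod dfun_div dfun_power2)
qed

subsection \<open>Definability of runs\<close>

text \<open>Variable \<open>0\<close> of the environment is the input and variable \<open>j + 1\<close> is the \<open>j\<close>-th arbitrary large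
  number. The register contents are described through their values at definable addresses, which
  is what indirect addressing requires.\<close>
definition trackable :: "nat \<Rightarrow> ((nat \<Rightarrow> nat) \<Rightarrow> state option) \<Rightarrow> bool" where
  "trackable t s = (\<exists>N pc R k. definable N \<and> dfun pc \<and> (\<forall>F. dfun F \<longrightarrow> dfun (\<lambda>e. R e (F e))) \<and> dfun k
     \<and> (\<forall>e. k e \<le> t) \<and> (\<forall>e. s e = (if N e then None else Some (pc e, R e, k e))))"

lemma trackableI:
  assumes "definable N" "dfun pc" "\<And>F. dfun F \<Longrightarrow> dfun (\<lambda>e. R e (F e))" "dfun k" "\<And>e. k e \<le> t"
    "\<And>e. s e = (if N e then None else Some (pc e, R e, k e))"
  shows "trackable t s"
  unfolding trackable_def using assms by blast

lemma trackable_if: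
  assumes "definable c" "trackable t s" "trackable t s'"
  shows "trackable t (\<lambda>e. if c e then s e else s' e)"
proof -
  obtain N pc R k where s: "definable N" "dfun pc" "\<And>F. dfun F \<Longrightarrow> dfun (\<lambda>e. R e (F e))"
    "dfun k" "\<And>e. k e \<le> t" "\<And>e. s e = (if N e then None else Some (pc e, R e, k e))"
    using assms(2) unfolding trackable_def by blast
  obtain N' pc' R' k' where s': "definable N'" "dfun pc'" "\<And>F. dfun F \<Longrightarrow> dfun (\<lambda>e. R' e (F e))"
    "dfun k'" "\<And>e. k' e \<le> t" "\<And>e. s' e = (if N' e then None else Some (pc' e, R' e, k' e))"
    using assms(3) unfolding trackable_def by blast
  show ?thesis
  proof (rule trackableI[where R = "\<lambda>e x. if c e then R e x else R' e x"])
    show "definable (\<lambda>e. (c e \<and> N e) \<or> (\<not> c e \<and> N' e))"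
      by (intro definable_conj definable_disj definable_not assms s s')
    show "dfun (\<lambda>e. if c e then pc e else pc' e)" "dfun (\<lambda>e. if c e then k e else k' e)"
      by (intro dfun_if assms s s')+
    show "dfun (\<lambda>e. if c e then R e (F e) else R' e (F e))" if "dfun F" for F
      by (intro dfun_if assms s s' that)
    show "(if c e then k e else k' e) \<le> t" for e using s(5) s'(5) by simp
    show "(if c e then s e else s' e) = (if (c e \<and> N e) \<or> (\<not> c e \<and> N' e) then None
      else Some (if c e then pc e else pc' e, \<lambda>x. if c e then R e x else R' e x, if c e then k e else k' e))" for e
      using s(6) s'(6) by auto
  qed
qed

text \<open>\<open>step\<close> with a fixed instruction. The program counter varies with the
  environment, so \<open>trackable_step\<close> splits into its finitely many values inside the
  program, each with a known instruction.\<close>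

definition exec :: "instr \<Rightarrow> (nat \<Rightarrow> nat) \<Rightarrow> state \<Rightarrow> state option" where
  "exec i A s = (case s of (pc, R, k) \<Rightarrow>
     (case i of
        LoadConst d c \<Rightarrow> Some (Suc pc, R(d := c), k)
      | Move d a \<Rightarrow> Some (Suc pc, R(d := R a), k)
      | LoadInd d a \<Rightarrow> Some (Suc pc, R(d := R (R a)), k)
      | StoreInd d a \<Rightarrow> Some (Suc pc, R(R d := R a), k)
      | Add d a b \<Rightarrow> Some (Suc pc, R(d := R a + R b), k)
      | ExDiv d a b \<Rightarrow> (if R b \<noteq> 0 \<and> R b dvd R a
                         then Some (Suc pc, R(d := R a div R b), k) else None)
      | Shl d a b \<Rightarrow> Some (Suc pc, R(d := R a * 2 ^ R b), k)
      | BoolOp f d a b \<Rightarrow> (if \<not> f False False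
                         then Some (Suc pc, R(d := bitop f (R a) (R b)), k) else None)
      | JumpEq a b t \<Rightarrow> Some (if R a = R b then t else Suc pc, R, k)
      | Aln d \<Rightarrow> Some (Suc pc, R(d := A k), Suc k)
      | Halt \<Rightarrow> Some s))"

lemma step_eq_exec: "step P A (pc, R, k) = (if pc < length P then exec (P ! pc) A (pc, R, k) else Some (pc, R, k))"
  by (auto simp: step_def exec_def final_def)

text \<open>Which variable is read depends on the environment. The bound on \<open>k\<close> reduces
  this to a finite case distinction, which is why \<open>trackable\<close> bounds the number of ALN
  calls.\<close>

lemma dfun_index:
  assumes "dfun k" "\<And>e. k e \<le> t"
  shows "dfun (\<lambda>e. e (Suc (k e)))"
proof -
  have "dfun (\<lambda>e. if k e < n then e (Suc (k e)) else 0)" for n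
  proof (induction n)
    case 0
    then show ?case by (simp add: dfun_const)
  next
    case (Suc n)
    have "dfun (\<lambda>e. if k e = n then e (Suc n) else (if k e < n then e (Suc (k e)) else 0))"
      by (intro dfun_if definable_eq assms(1) dfun_var dfun_const Suc)
    moreover have "(\<lambda>e. if k e = n then e (Suc n) else (if k e < n then e (Suc (k e)) else 0))
        = (\<lambda>e. if k e < Suc n then e (Suc (k e)) else 0)" by auto
    ultimately show ?case by simp
  qed
  from this[of "Suc t"] show ?thesis using assms(2) by (simp add: less_Suc_eq_le)
qed

context
  fixes t :: nat and pc :: "(nat \<Rightarrow> nat) \<Rightarrow> nat" and R :: "(nat \<Rightarrow> nat) \<Rightarrow> nat \<Rightarrow> nat"
    and k :: "(nat \<Rightarrow> nat) \<Rightarrow> nat"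
  assumes pc: "dfun pc" and R: "\<And>F. dfun F \<Longrightarrow> dfun (\<lambda>e. R e (F e))" and k: "dfun k" and k_le: "\<And>e. k e \<le> t"
begin

lemma trackable_state: "trackable (Suc t) (\<lambda>e. Some (pc e, R e, k e))"
  by (rule trackableI[OF definable_const[of False] pc R k]) (use k_le[THEN le_SucI] in auto)

lemma trackable_update:
  assumes "definable N" "dfun d" "dfun v"
  shows "trackable (Suc t) (\<lambda>e. if N e then None else Some (Suc (pc e), (R e)(d e := v e), k e))"
proof (rule trackableI[OF assms(1) dfun_Suc[OF pc] _ k])
  show "dfun (\<lambda>e. ((R e)(d e := v e)) (F e))" if "dfun F" for F
    unfolding fun_upd_apply by (intro dfun_if definable_eq assms R that)
  show "k e \<le> Suc t" for e using k_le[of e] by simp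
qed simp

lemma trackable_exec: "trackable (Suc t) (\<lambda>e. exec i (\<lambda>j. e (Suc j)) (pc e, R e, k e))"
proof (cases i)
  case (LoadConst d c)
  then show ?thesis
    using trackable_update[OF definable_const[of False] dfun_const[of d] dfun_const[of c]] by (simp add: exec_def)
next
  case (Move d a)
  then show ?thesis
    using trackable_update[OF definable_const[of False] dfun_const[of d] R[OF dfun_const[of a]]] by (simp add: exec_def)
next
  case (LoadInd d a)
  then show ?thesis
    using trackable_update[OF definable_const[of False] dfun_const[of d] R[OF R[OF dfun_const[of a]]]]
    by (simp add: exec_def)
next
  case (StoreInd d a)
  then show ?thesis
    using trackable_update[OF definable_const[of False] R[OF dfun_const[of d]] R[OF dfun_const[of a]]]
    by (simp add: exec_def)
next
  case (Add d a b)
  then show ?thesis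
    using trackable_update[OF definable_const[of False] dfun_const[of d]
        dfun_add[OF R[OF dfun_const[of a]] R[OF dfun_const[of b]]]]
    by (simp add: exec_def)
next
  case (ExDiv d a b)
  let ?N = "\<lambda>e. R e b = 0 \<or> \<not> (R e a mod R e b = 0)"
  have "definable ?N"
    by (intro definable_disj definable_not definable_eq dfun_mod R dfun_const)
  from trackable_update[OF this dfun_const[of d] dfun_div[OF R[OF dfun_const[of a]] R[OF dfun_const[of b]]]]
  have "trackable (Suc t) (\<lambda>e. if ?N e then None else Some (Suc (pc e), (R e)(d := R e a div R e b), k e))" .
  moreover have "(\<lambda>e. if ?N e then None else Some (Suc (pc e), (R e)(d := R e a div R e b), k e))
      = (\<lambda>e. exec i (\<lambda>j. e (Suc j)) (pc e, R e, k e))"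
    by (rule ext) (auto simp: exec_def ExDiv mod_eq_0_iff_dvd)
  ultimately show ?thesis by simp
next
  case (Shl d a b)
  then show ?thesis
    using trackable_update[OF definable_const[of False] dfun_const[of d]
        dfun_mult[OF R[OF dfun_const[of a]] dfun_power2[OF R[OF dfun_const[of b]]]]]
    by (simp add: exec_def)
next
  case (BoolOp f d a b)
  show ?thesis
  proof (cases "f False False")
    case True
    then show ?thesis
      using trackable_update[OF definable_const[of True] dfun_const[of d] dfun_const[of d]]
      by (simp add: exec_def BoolOp)
  next
    case False
    then show ?thesis
      using trackable_update[OF definable_const[of False] dfun_const[of d]
          dfun_bitop[where f = f, OF False R[OF dfun_const[of a]] R[OF dfun_const[of b]]]]
      by (simp add: exec_def BoolOp)
  qed
next
  case (JumpEq a b u)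
  have "dfun (\<lambda>e. if R e a = R e b then u else Suc (pc e))"
    by (intro dfun_if definable_eq R dfun_const dfun_Suc pc)
  then have "trackable (Suc t) (\<lambda>e. Some (if R e a = R e b then u else Suc (pc e), R e, k e))"
    by (rule trackableI[OF definable_const[of False] _ R k]) (use k_le[THEN le_SucI] in auto)
  then show ?thesis by (simp add: exec_def JumpEq)
next
  case (Aln d)
  have "trackable (Suc t) (\<lambda>e. Some (Suc (pc e), (R e)(d := e (Suc (k e))), Suc (k e)))"
  proof (rule trackableI[OF definable_const[of False] dfun_Suc[OF pc] _ dfun_Suc[OF k]])
    show "dfun (\<lambda>e. ((R e)(d := e (Suc (k e)))) (F e))" if "dfun F" for F
      unfolding fun_upd_apply
      by (intro dfun_if definable_eq dfun_index[OF k k_le] R that dfun_const)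
    show "Suc (k e) \<le> Suc t" for e using k_le[of e] by simp
  qed simp
  then show ?thesis by (simp add: exec_def Aln)
next
  case Halt
  then show ?thesis using trackable_state by (simp add: exec_def)
qed

lemma trackable_step: "trackable (Suc t) (\<lambda>e. step P (\<lambda>j. e (Suc j)) (pc e, R e, k e))"
proof -
  have "trackable (Suc t) (\<lambda>e. if pc e < n then exec (P ! pc e) (\<lambda>j. e (Suc j)) (pc e, R e, k e)
      else Some (pc e, R e, k e))" for n
  proof (induction n)
    case 0
    then show ?case using trackable_state by simp
  next
    case (Suc n)
    let ?s = "\<lambda>n e. if pc e < n then exec (P ! pc e) (\<lambda>j. e (Suc j)) (pc e, R e, k e)
      else Some (pc e, R e, k e)"
    have "trackable (Suc t) (\<lambda>e. if pc e = n then exec (P ! n) (\<lambda>j. e (Suc j)) (pc e, R e, k e) else ?s n e)"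
      by (intro trackable_if definable_eq pc dfun_const trackable_exec Suc)
    moreover have "(\<lambda>e. if pc e = n then exec (P ! n) (\<lambda>j. e (Suc j)) (pc e, R e, k e) else ?s n e) = ?s (Suc n)"
      by (rule ext) auto
    ultimately show ?case by simp
  qed
  then show ?thesis unfolding step_eq_exec .
qed

end

lemma trackable_run: "trackable t (\<lambda>e. run P (\<lambda>j. e (Suc j)) (init (e 0)) t)"
proof (induction t)
  case 0
  show ?case
  proof (rule trackableI[OF definable_const[of False] dfun_const[of 0] _ dfun_const[of 0]])
    show "dfun (\<lambda>e. ((\<lambda>_. 0)(0 := e 0)) (F e))" if "dfun F" for F
      unfolding fun_upd_apply by (intro dfun_if definable_eq dfun_const dfun_var that)
  qed (simp_all add: init_def)
next
  case (Suc t)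
  let ?run = "\<lambda>e. run P (\<lambda>j. e (Suc j)) (init (e 0))"
  obtain N pc R k where s: "definable N" "dfun pc" "\<And>F. dfun F \<Longrightarrow> dfun (\<lambda>e. R e (F e))"
    "dfun k" "\<And>e. k e \<le> t" "\<And>e. ?run e t = (if N e then None else Some (pc e, R e, k e))"
    using Suc unfolding trackable_def by blast
  \<comment> \<open>\<open>if True then None\<close> expresses abortion in the shape that
    \<open>trackable_update\<close> supplies; the state in the other branch is a dummy.\<close>
  have "trackable (Suc t) (\<lambda>e. if \<not> N e then step P (\<lambda>j. e (Suc j)) (pc e, R e, k e)
      else (if True then None else Some (Suc (pc e), (R e)(0 := 0), k e)))"
    by (intro trackable_if definable_not s(1) trackable_step[OF s(2-5)]
        trackable_update[OF s(2-5)] definable_const dfun_const)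
  moreover have "?run e (Suc t) = (if \<not> N e then step P (\<lambda>j. e (Suc j)) (pc e, R e, k e)
      else (if True then None else Some (Suc (pc e), (R e)(0 := 0), k e)))" for e
    using run_add[of P "\<lambda>j. e (Suc j)" "init (e 0)" t 1] s(6)[of e]
    by (auto split: option.split simp del: run.simps(2) simp: run.simps(2)[where n = 0, simplified])
  ultimately show ?case by (simp del: run.simps)
qed

text \<open>Running for exactly \<open>t\<close> steps loses nothing when \<open>t\<close> bounds
  the time, since \<open>step\<close> leaves final states unchanged.\<close>

definition accepted :: "instr list \<Rightarrow> nat \<Rightarrow> (nat \<Rightarrow> nat) \<Rightarrow> bool" where
  "accepted P t e = (\<exists>s. run P (\<lambda>j. e (Suc j)) (init (e 0)) t = Some s \<and> fst (snd s) 0 \<noteq> 0)"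

lemma definable_accepted: "definable (accepted P t)"
proof -
  obtain N pc R k where s: "definable N" "\<And>F. dfun F \<Longrightarrow> dfun (\<lambda>e. R e (F e))"
    "\<And>e. run P (\<lambda>j. e (Suc j)) (init (e 0)) t = (if N e then None else Some (pc e, R e, k e))"
    using trackable_run[of t P] unfolding trackable_def by blast
  have "definable (\<lambda>e. \<not> N e \<and> \<not> (R e 0 = 0))"
    by (intro definable_conj definable_not definable_eq s dfun_const)
  moreover have "accepted P t = (\<lambda>e. \<not> N e \<and> \<not> (R e 0 = 0))"
    by (auto simp: accepted_def s(3) fun_eq_iff)
  ultimately show ?thesis by simp
qed

lemma definable_almost_all: "definable \<phi> \<Longrightarrow> definable (almost_all r i \<phi>)"
proof (induction r arbitrary: i)
  case 0
  then show ?case by simp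
next
  case (Suc r)
  let ?\<psi> = "almost_all r (Suc i) \<phi>"
  \<comment> \<open>Under the two quantifiers \<open>x\<close> is variable 0 and the threshold
    \<open>m\<close> variable 1: \<open>x\<close> takes the place of entry \<open>i\<close>, all
    others shift by two.\<close>
  have "definable (\<lambda>e. ?\<psi> (\<lambda>j. e (if j = i then 0 else Suc (Suc j))))"
    by (rule definable_ren[OF Suc.IH[OF Suc.prems]])
  moreover have "(\<lambda>j. e (if j = i then 0 else Suc (Suc j))) = (\<lambda>j. e (Suc (Suc j)))(i := e 0)" for e :: "nat \<Rightarrow> nat"
    by auto
  ultimately have psi: "definable (\<lambda>e. ?\<psi> ((\<lambda>j. e (Suc (Suc j)))(i := e 0)))" by (simp only:)
  have "definable (\<lambda>e. \<exists>m. \<forall>x. \<not> x < m \<longrightarrow> ?\<psi> (e(i := x)))"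
    by (intro definable_ex definable_all definable_imp definable_not definable_less dfun_var psi)
  moreover have "almost_all (Suc r) i \<phi> = (\<lambda>e. \<exists>m. \<forall>x. \<not> x < m \<longrightarrow> ?\<psi> (e(i := x)))"
    by (rule ext) (simp only: almost_all.simps not_less)
  ultimately show ?case by simp
qed

section \<open>Recognisable languages are arithmetical\<close>

lemma almost_all_inputs:
  "almost_all r (Suc i) \<phi> (inputs n A) = almost_all r i (\<lambda>A. \<phi> (inputs n A)) A"
proof (induction r arbitrary: i A)
  case (Suc r)
  have "(inputs n A)(Suc i := x) = inputs n (A(i := x))" for x
    by (auto simp: inputs_def fun_eq_iff)
  then show ?case by (simp add: Suc del: fun_upd_apply)
qed simp

text \<open>A step calls ALN at most once, so \<open>n\<close> steps starting at call
  \<open>k\<close> read only entries below \<open>k + n\<close>.\<close>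

lemma run_cong:
  assumes "\<forall>j<k + n. A j = B j"
  shows "run P A (pc, R, k) n = run P B (pc, R, k) n"
  using assms
proof (induction n arbitrary: pc R k)
  case (Suc n)
  have eq: "step P A (pc, R, k) = step P B (pc, R, k)"
    using Suc.prems by (simp add: step_eq_exec exec_def split: instr.split)
  have "run P A s n = run P B s n" if "step P B (pc, R, k) = Some s" for s
  proof -
    obtain pc' R' k' where s: "s = (pc', R', k')" by (cases s)
    have "k' \<le> Suc k" using that unfolding s
      by (auto simp: step_eq_exec exec_def split: instr.splits if_splits)
    then show ?thesis unfolding s using Suc.prems by (intro Suc.IH) auto
  qed
  then show ?case by (simp add: eq split: option.split)
qed simp

lemma run_final: "final P s \<Longrightarrow> run P A s n = Some s"
  by (induction n) (auto simp: step_def split: prod.split)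

text \<open>An aborted run stays aborted, so a run that halts can stop in time only by reaching a
  final state, which then persists up to step \<open>t\<close>.\<close>

lemma halts_with_run:
  assumes "halts_with P A inp v" "stops_within P A inp t"
  shows "\<exists>s. run P A (init inp) t = Some s \<and> fst (snd s) 0 = v"
proof -
  obtain n s where n: "run P A (init inp) n = Some s" "final P s" "fst (snd s) 0 = v"
    using assms(1) unfolding halts_with_def by blast
  obtain m where m: "m \<le> t" "run P A (init inp) m = None \<or> (\<exists>s. run P A (init inp) m = Some s \<and> final P s)"
    using assms(2) unfolding stops_within_def by blast
  have later: "run P A (init inp) j = Some s'" if "run P A (init inp) i = Some s'" "final P s'" "i \<le> j" for i j s'
    using run_add[of P A "init inp" i "j - i"] that by (simp add: run_final)
  have none: "run P A (init inp) j = None" if "run P A (init inp) i = None" "i \<le> j" for i j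
    using run_add[of P A "init inp" i "j - i"] that by simp
  show ?thesis
  proof (cases "n \<le> t")
    case True
    then show ?thesis using later[OF n(1,2)] n(3) by blast
  next
    case False
    then have "m \<le> n" using m(1) by simp
    then show ?thesis using m none[of m n] later[of m _ n] later[of m _ t] n by fastforce
  qed
qed

text \<open>Repeating the increment of ALS reaches every value from \<open>A i\<close> on at entry
  \<open>i\<close> with the earlier entries kept, so \<open>A i\<close> itself is a
  threshold.\<close>

lemma ALS_imp_almost_all:
  assumes "ALS S" "\<And>A. A \<in> S \<Longrightarrow> Q A" "A \<in> S"
    and cong: "\<And>A B. \<forall>j<i + r. A j = B j \<Longrightarrow> Q A = Q B"
  shows "almost_all r i Q A"
  using assms(3) cong
proof (induction r arbitrary: i A)
  case 0
  then show ?case using assms(2) by simp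
next
  case (Suc r)
  have "\<exists>B\<in>S. B i = A i + y \<and> (\<forall>j<i. B j = A j)" for y
  proof (induction y)
    case 0
    then show ?case using Suc.prems(1) by auto
  next
    case (Suc y)
    then obtain B where "B \<in> S" "B i = A i + y" "\<forall>j<i. B j = A j" by blast
    moreover then obtain C where "C \<in> S" "C i = B i + 1" "\<forall>j<i. C j = B j"
      using assms(1) unfolding ALS_def by blast
    ultimately show ?case by (intro bexI[of _ C]) auto
  qed
  note reach = this
  have cong': "Q X = Q Y" if "\<forall>j<Suc i + r. X j = Y j" for X Y
    by (rule Suc.prems(2)) (use that in \<open>simp only: add_Suc_right add_Suc\<close>)
  have "almost_all r (Suc i) Q (A(i := x))" if "A i \<le> x" for x
  proof -
    obtain B where B: "B \<in> S" "B i = A i + (x - A i)" "\<forall>j<i. B j = A j"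
      using reach by blast
    have "almost_all r (Suc i) Q B"
      by (rule Suc.IH[OF B(1)]) (rule cong')
    \<comment> \<open>\<open>B\<close> agrees with \<open>A(i := x)\<close> only up to entry
      \<open>i\<close>; the entries after that on which \<open>Q\<close> depends are
      requantified.\<close>
    moreover have "almost_all r (Suc i) Q B = almost_all r (Suc i) Q (A(i := x))"
    proof (rule almost_all_cong)
      show "\<forall>j<Suc i. B j = (A(i := x)) j" using B(2,3) that by (simp add: less_Suc_eq)
    qed (rule cong')
    ultimately show ?thesis by (simp only:)
  qed
  then show ?case unfolding almost_all.simps by blast
qed

lemma almost_all_False: "\<not> almost_all r i (\<lambda>_. False) c"
  by (induction r arbitrary: i c) auto

lemma ASRAM_subset_AH: "ASRAM_O1 \<subseteq> AH"
proof
  fix L assume "L \<in> ASRAM_O1"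
  then obtain P f t where comp: "\<And>n. \<exists>S. ALS S \<and> (\<forall>A\<in>S. halts_with P A n (f n))"
    and f: "\<And>n. f n \<noteq> 0 \<longleftrightarrow> n \<in> L" and time: "\<And>A n. stops_within P A n t"
    unfolding ASRAM_O1_def asram_recognises_def asram_computes_def asram_const_time_def by blast
  let ?zero = "(\<lambda>_. 0) :: nat \<Rightarrow> nat"
  have cong: "accepted P t (inputs n A) = accepted P t (inputs n B)" if "\<forall>j<t. A j = B j" for n A B
    using run_cong[of 0 t A B P 0 "?zero(0 := n)"] that
    by (simp add: accepted_def inputs_def init_def)
  have acc: "almost_all t 0 (\<lambda>A. accepted P t (inputs n A) = (n \<in> L)) ?zero" for n
  proof -
    let ?Q = "\<lambda>A. accepted P t (inputs n A) = (n \<in> L)"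
    obtain S where S: "ALS S" "\<And>A. A \<in> S \<Longrightarrow> halts_with P A n (f n)" using comp by blast
    have Q: "?Q A" if "A \<in> S" for A
      using halts_with_run[OF S(2)[OF that] time] f[of n] by (auto simp: accepted_def inputs_def)
    obtain A where A: "A \<in> S" using S(1) unfolding ALS_def by blast
    have "almost_all t 0 ?Q A"
    proof (rule ALS_imp_almost_all[OF S(1) _ A])
      show "?Q A" if "A \<in> S" for A using Q[OF that] .
      show "?Q A = ?Q B" if "\<forall>j<0 + t. A j = B j" for A B using that cong[of A B n] by simp
    qed
    moreover have "almost_all t 0 ?Q A = almost_all t 0 ?Q ?zero"
    proof (rule almost_all_cong)
      show "?Q A = ?Q B" if "\<forall>j<0 + t. A j = B j" for A B using that cong[of A B n] by simp
    qed simp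
    ultimately show ?thesis by simp
  qed
  have "n \<in> L \<longleftrightarrow> almost_all t 1 (accepted P t) (?zero(0 := n))" for n
  proof -
    have zero: "inputs n ?zero = ?zero(0 := n)" by (auto simp: inputs_def)
    have "n \<in> L \<longleftrightarrow> almost_all t 0 (\<lambda>A. accepted P t (inputs n A)) ?zero"
    proof
      assume "n \<in> L"
      then show "almost_all t 0 (\<lambda>A. accepted P t (inputs n A)) ?zero" using acc[of n] by simp
    next
      assume "almost_all t 0 (\<lambda>A. accepted P t (inputs n A)) ?zero"
      \<comment> \<open>If \<open>n\<close> were outside \<open>L\<close>, acceptance and
        non-acceptance would both hold for almost all values, which \<open>almost_all_False\<close>
        excludes.\<close>
      from almost_all_conj[OF this acc[of n]]
      have "almost_all t 0 (\<lambda>A. n \<in> L) ?zero" by (rule almost_all_mono) blast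
      then show "n \<in> L" using almost_all_False[of t 0 ?zero] by (cases "n \<in> L") auto
    qed
    then show ?thesis using almost_all_inputs[of t 0 "accepted P t" n ?zero] by (simp add: zero)
  qed
  moreover obtain p where p: "prenex p" "\<And>e. sat e p = almost_all t 1 (accepted P t) e"
    using definable_almost_all[OF definable_accepted] unfolding definable_def by blast
  ultimately have "L = defined_set p" by (auto simp: defined_set_def)
  moreover obtain n where "sigma_fm n p" using prenex_sigma_fm[OF p(1)] by blast
  ultimately show "L \<in> AH" unfolding AH_def Sigma0_def by blast
qed

theorem theorem3:
  shows "ASRAM_O1 = AH"
  using ASRAM_subset_AH defined_set_ASRAM by (auto simp: AH_def Sigma0_def Pi0_def)

end
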